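(* Let $a_{05},a_{14},a_{23},a_{32},a_{41},a_{50}\in\mathbb{R}$ and consider the polynomial differential system in the plane $\mathbb{R}^2$ $$\dot{x}= y,\qquad \dot{y}=-x+a_{05}\,y^5+a_{14}\,x\,y^4+a_{23}\,x^2\,y^3+a_{32}\,x^3\,y^2+a_{41}\,x^4\,y+a_{50}\,x^5.$$ This system has a center at the origin of coordinates and the origin is its unique equilibrium point in $\mathbb{R}^2$ if and only if $$a_{50}\leq 0\qquad\text{and}\qquad a_{41}=a_{23}=a_{05}=0.$$
   Context: The dot denotes the derivative with respect to the time $t$. A center of a differential system in $\mathbb{R}^2$ is an equilibrium point $p$ having a neighborhood $U$ such that $U\setminus\{p\}$ is filled with periodic orbits (i.e. every point of $U\setminus\{p\}$ lies on a non-constant periodic orbit). *)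

theory Defs
  imports "HOL-Analysis.Analysis"
begin

definition global_solution :: "('a::real_normed_vector \<Rightarrow> 'a) \<Rightarrow> (real \<Rightarrow> 'a) \<Rightarrow> bool" where
  "global_solution F u \<longleftrightarrow> (\<forall>t. (u has_vector_derivative F (u t)) (at t))"

(* Periodic solutions are defined for all times, so requiring a global solution
   excludes no periodic orbit. *)
definition periodic_orbit :: "('a::real_normed_vector \<Rightarrow> 'a) \<Rightarrow> 'a set \<Rightarrow> bool" where
  "periodic_orbit F \<Gamma> \<longleftrightarrow>
     (\<exists>u T. global_solution F u \<and> T > 0 \<and> (\<forall>t. u (t + T) = u t) \<and>
            \<not> u constant_on UNIV \<and> \<Gamma> = range u)"

definition equilibrium_point :: "('a::real_normed_vector \<Rightarrow> 'a) \<Rightarrow> 'a \<Rightarrow> bool" where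
  "equilibrium_point F p \<longleftrightarrow> F p = 0"

(* The neighborhood U need not be open, and the orbits are not required to stay in U. *)
definition center :: "(real \<times> real \<Rightarrow> real \<times> real) \<Rightarrow> real \<times> real \<Rightarrow> bool" where
  "center F p \<longleftrightarrow> equilibrium_point F p \<and>
     (\<exists>U. p \<in> interior U \<and> (\<forall>q \<in> U - {p}. \<exists>\<Gamma>. periodic_orbit F \<Gamma> \<and> q \<in> \<Gamma>))"

definition quintic_field ::
  "real \<Rightarrow> real \<Rightarrow> real \<Rightarrow> real \<Rightarrow> real \<Rightarrow> real \<Rightarrow> real \<times> real \<Rightarrow> real \<times> real" where
  "quintic_field a05 a14 a23 a32 a41 a50 = (\<lambda>(x, y).
     (y, - x + a05 * y^5 + a14 * x * y^4 + a23 * x^2 * y^3 + a32 * x^3 * y^2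
             + a41 * x^4 * y + a50 * x^5))"

end

theory Submission
  imports Defs
begin

text \<open>Write the system as \<open>x' = y\<close>, \<open>y' = - x + Q x y\<close> with \<open>Q\<close> homogeneous of degree five, and
split \<open>Q\<close> into the part even in \<open>y\<close> (coefficients \<open>a14\<close>, \<open>a32\<close>, \<open>a50\<close>) and the part odd in \<open>y\<close>
(coefficients \<open>a05\<close>, \<open>a23\<close>, \<open>a41\<close>). An equilibrium has \<open>y = 0\<close> and \<open>x * (a50 * x^4 - 1) = 0\<close>, so
uniqueness of the equilibrium is the condition \<open>a50 \<le> 0\<close>. What remains is that the origin is a
center exactly when the odd part vanishes.

If the odd part vanishes, the system is reversible: \<open>(x, y, t) \<mapsto> (x, - y, - t)\<close> maps solutions to
solutions. A small solution stays close to a uniform rotation for several turns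
(\<open>solution_rotates\<close>), hence meets the axis \<open>y = 0\<close> at two times \<open>t1 < t2\<close>. Reflecting it in time
at \<open>t1\<close> and then at \<open>t2\<close> reproduces it, so it has period \<open>2 * (t2 - t1)\<close> (\<open>reversible_center\<close>).
Solutions are obtained from a Picard--Lindeloef theorem for globally Lipschitz fields, applied to
the field with the coordinates in the nonlinear part clamped to a small square.

For the converse, look for a first integral \<open>(x^2 + y^2) / 2 + H 1 + H 2 + \<dots>\<close> with \<open>H j\<close> a form of
degree \<open>4 * j + 2\<close>. Each \<open>H (j + 1)\<close> has to solve a linear equation whose left side is \<open>y * d/dx -
x * d/dy\<close>; the equation can be solved up to a multiple of a positive definite form, and if that
multiple is not zero, the partial sum is a strict Lyapunov function for the system or for its time
reversal, which excludes periodic orbits near the origin. So a center has a formal first integral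
(\<open>center_imp_formal_integral\<close>), and all its Lyapunov quantities vanish.

The first quantity gives \<open>a41 = - 5 * a05 - a23\<close>, the second one an equation bilinear in the odd
and the even coefficients. The next three, of degrees three, four and five in the coefficients
(\<open>formal_integral_conditions\<close>), are computed by duality: instead of propagating the forms \<open>H j\<close> up
to degree 18, the linear functional that detects the obstruction is pulled back to degree 10,
where the form is explicit. Over the complex numbers these equations do have nontrivial solutions.
In coordinates \<open>(h, k, s)\<close> adapted to the bilinear equation such solutions are visible at \<open>k^2 =
-1\<close>, \<open>s = 0\<close>; this is why \<open>1 + k^2\<close> occurs everywhere and why the last step must use inequalities.
Elimination leaves one polynomial of degree eight in \<open>h\<close>, and at every real root of it a sign
condition derived from the third quantity is violated (\<open>no_real_common_zero\<close>). Hence the odd part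
vanishes (\<open>lyapunov_quantities_vanish\<close>).\<close>

section \<open>Global solutions of Lipschitz differential equations\<close>

lemma antiderivative_on_line:
  fixes f :: "real \<Rightarrow> 'a::euclidean_space"
  assumes "continuous_on UNIV f"
  shows "\<exists>F. F 0 = p \<and> (\<forall>t. (F has_vector_derivative f t) (at t))"
proof -
  have "\<exists>F. \<forall>x::real. - \<infinity> < ereal x \<longrightarrow> ereal x < \<infinity> \<longrightarrow> (F has_vector_derivative f x) (at x)"
    by (rule einterval_antiderivative)
      (use assms in \<open>auto simp: continuous_on_eq_continuous_at\<close>)
  then obtain F where F: "\<And>x. (F has_vector_derivative f x) (at x)" by auto
  have "((\<lambda>t. F t + (p - F 0)) has_vector_derivative f x) (at x)" for x
    by (auto intro!: derivative_eq_intros F)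
  then show ?thesis
    by (intro exI[of _ "\<lambda>t. F t + (p - F 0)"]) auto
qed

text \<open>The weight \<open>exp (K * \<bar>t\<bar>)\<close> is reproduced by integration up to the factor \<open>1 / K\<close>. In this
weight the Picard map for a Lipschitz field is therefore a contraction on the whole line at once,
and no solution has to be continued from one short time interval to the next.\<close>

lemma norm_le_exp_of_deriv_norm_le:
  fixes f :: "real \<Rightarrow> 'a::real_normed_vector"
  assumes f: "\<And>t. (f has_vector_derivative f' t) (at t)" and f0: "f 0 = 0"
    and bound: "\<And>t. norm (f' t) \<le> C * K * exp (K * \<bar>t\<bar>)" and "0 \<le> C"
  shows "norm (f t) \<le> C * exp (K * \<bar>t\<bar>)"
proof -
  have pos: "norm (h t) \<le> C * exp (K * t)"
    if "0 < t" "h 0 = 0" and h: "\<And>t. (h has_vector_derivative h' t) (at t)"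
      and b: "\<And>t. 0 < t \<Longrightarrow> norm (h' t) \<le> C * K * exp (K * t)" for h h' :: "real \<Rightarrow> 'a" and t
  proof -
    have "norm (h t - h 0) \<le> C * exp (K * t) - C * exp (K * 0)"
    proof (rule differentiable_bound_general[OF \<open>0 < t\<close>, of h "\<lambda>t. C * exp (K * t)" h' "\<lambda>t. C * K * exp (K * t)"])
      show "continuous_on {0..t} h"
        using h by (intro continuous_at_imp_continuous_on ballI) (rule has_vector_derivative_continuous)
      show "((\<lambda>t. C * exp (K * t)) has_vector_derivative C * K * exp (K * x)) (at x)" for x
        unfolding has_real_derivative_iff_has_vector_derivative[symmetric]
        by (auto intro!: derivative_eq_intros)
    qed (auto intro!: continuous_intros h b)
    then show ?thesis using \<open>h 0 = 0\<close> \<open>0 \<le> C\<close> by simp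
  qed
  consider "t = 0" | "0 < t" | "t < 0" by linarith
  then show ?thesis
  proof cases
    case 2
    then show ?thesis using pos[OF 2 f0 f] bound by (metis abs_of_pos)
  next
    case 3
    have "((\<lambda>s. f (- s)) has_vector_derivative - f' (- s)) (at s)" for s
    proof -
      have "(f \<circ> uminus has_vector_derivative (- 1) *\<^sub>R f' (- s)) (at s)"
        by (rule vector_diff_chain_at) (auto intro!: derivative_eq_intros f)
      then show ?thesis by (simp add: o_def)
    qed
    moreover have "norm (- f' (- s)) \<le> C * K * exp (K * s)" if "0 < s" for s
      using bound[of "- s"] that by simp
    ultimately have "norm (f (- (- t))) \<le> C * exp (K * (- t))"
      using 3 f0 by (intro pos[of "- t" "\<lambda>s. f (- s)" "\<lambda>s. - f' (- s)"]) auto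
    then show ?thesis using 3 by simp
  qed (use f0 \<open>0 \<le> C\<close> in simp)
qed

text \<open>Picard iteration. With the weight \<open>exp (2 * K * \<bar>t\<bar>)\<close> consecutive iterates approach each
other by a factor of one half per step, so they converge locally uniformly; the limit is a fixed
point because the antiderivative of the field along the limit is also a limit of the iterates.\<close>

lemma lipschitz_global_solution_exists:
  fixes G :: "'a::euclidean_space \<Rightarrow> 'a"
  assumes G: "L-lipschitz_on UNIV G"
  shows "\<exists>u. global_solution G u \<and> u 0 = p"
proof -
  define K where "K = L + 1"
  have "K > 0" using lipschitz_on_nonneg[OF G] by (simp add: K_def)
  have GK: "norm (G x - G y) \<le> K * norm (x - y)" for x y
  proof -
    have "norm (G x - G y) \<le> L * norm (x - y)"
      by (rule lipschitz_on_normD[OF G]) auto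
    also have "\<dots> \<le> K * norm (x - y)" by (simp add: K_def mult_right_mono)
    finally show ?thesis .
  qed
  have G_cont: "continuous_on UNIV (\<lambda>t. G (u t))" if "continuous_on UNIV u" for u :: "real \<Rightarrow> 'a"
    using continuous_on_compose[OF that] lipschitz_on_continuous_on[OF G]
    by (metis (no_types, lifting) comp_def continuous_on_cong continuous_on_subset subset_UNIV)
  define P where "P f = (SOME F. F 0 = p \<and> (\<forall>t. (F has_vector_derivative f t) (at t)))" for f :: "real \<Rightarrow> 'a"
  have P: "P f 0 = p" "\<And>t. (P f has_vector_derivative f t) (at t)" if "continuous_on UNIV f" for f
    using someI_ex[OF antiderivative_on_line[OF that, of p]] by (auto simp: P_def)
  define U where "U n = ((\<lambda>u. P (\<lambda>t. G (u t))) ^^ n) (\<lambda>_. p)" for n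
  have U_Suc: "U (Suc n) = P (\<lambda>t. G (U n t))" for n by (simp add: U_def)
  have U_cont: "continuous_on UNIV (U n)" for n
  proof (induction n)
    case (Suc n)
    then show ?case
      using has_vector_derivative_continuous[OF P(2)[OF G_cont[OF Suc]]]
      by (simp add: U_Suc continuous_at_imp_continuous_on)
  qed (simp add: U_def)
  have U_0: "U n 0 = p" for n
    by (cases n) (simp_all add: U_def P(1)[OF G_cont[OF U_cont[unfolded U_def]]])
  have U_der: "(U (Suc n) has_vector_derivative G (U n t)) (at t)" for n t
    unfolding U_Suc by (rule P(2)[OF G_cont[OF U_cont]])
  define M where "M = norm (G p) / (2 * K)"
  define E where "E t = exp (2 * K * \<bar>t\<bar>)" for t :: real
  have "M \<ge> 0" using \<open>K > 0\<close> by (simp add: M_def)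
  have step: "norm (U (Suc n) t - U n t) \<le> M / 2 ^ n * E t" for n t
    unfolding E_def
  proof (induction n arbitrary: t)
    case 0
    show ?case
    proof (rule norm_le_exp_of_deriv_norm_le[where f' = "\<lambda>_. G p"])
      have "U 0 = (\<lambda>_. p)" by (simp add: U_def)
      then show "((\<lambda>t. U (Suc 0) t - U 0 t) has_vector_derivative G p) (at t)" for t
        using U_der[of 0 t] by (auto intro!: derivative_eq_intros)
      have "norm (G p) * 1 \<le> norm (G p) * exp (2 * K * \<bar>t\<bar>)" for t
        using \<open>K > 0\<close> by (intro mult_left_mono) auto
      then show "norm (G p) \<le> M / 2 ^ 0 * (2 * K) * exp (2 * K * \<bar>t\<bar>)" for t
        using \<open>K > 0\<close> by (simp add: M_def)
    qed (simp_all add: U_0 \<open>M \<ge> 0\<close>)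
  next
    case (Suc n)
    show ?case
    proof (rule norm_le_exp_of_deriv_norm_le[where f' = "\<lambda>t. G (U (Suc n) t) - G (U n t)"])
      show "((\<lambda>t. U (Suc (Suc n)) t - U (Suc n) t) has_vector_derivative G (U (Suc n) t)
          - G (U n t)) (at t)" for t
        by (intro derivative_intros U_der)
      fix t
      have "norm (G (U (Suc n) t) - G (U n t)) \<le> K * (M / 2 ^ n * exp (2 * K * \<bar>t\<bar>))"
        using GK Suc \<open>K > 0\<close> by (meson mult_left_mono order_trans less_imp_le)
      then show "norm (G (U (Suc n) t) - G (U n t)) \<le> M / 2 ^ Suc n * (2 * K) * exp (2 * K * \<bar>t\<bar>)"
        by (simp add: field_simps)
    qed (simp_all add: U_0 \<open>M \<ge> 0\<close>)
  qed
  have tail: "norm (U (n + k) t - U n t) \<le> (2 * M / 2 ^ n - 2 * M / 2 ^ (n + k)) * E t" for n k t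
  proof (induction k)
    case (Suc k)
    have "norm (U (n + Suc k) t - U n t) \<le> norm (U (Suc (n + k)) t - U (n + k) t) + norm (U (n
        + k) t - U n t)"
      using norm_triangle_ineq[of "U (Suc (n + k)) t - U (n + k) t" "U (n + k) t - U n t"] by simp
    also have "\<dots> \<le> M / 2 ^ (n + k) * E t + (2 * M / 2 ^ n - 2 * M / 2 ^ (n + k)) * E t"
      using step Suc by (intro add_mono) auto
    also have "\<dots> = (2 * M / 2 ^ n - 2 * M / 2 ^ (n + Suc k)) * E t"
      by (simp add: field_simps)
    finally show ?case .
  qed simp
  have tail': "norm (U m t - U n t) \<le> 2 * M / 2 ^ n * E t" if "n \<le> m" for n m t
  proof -
    have "norm (U m t - U n t) \<le> (2 * M / 2 ^ n - 2 * M / 2 ^ m) * E t"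
      using tail[of n "m - n" t] that by simp
    also have "\<dots> \<le> 2 * M / 2 ^ n * E t"
      using \<open>M \<ge> 0\<close> by (intro mult_right_mono) (auto simp: E_def)
    finally show ?thesis .
  qed
  have small: "\<forall>\<^sub>F n in sequentially. 2 * M / 2 ^ n * C < e" if "e > 0" for e C
  proof -
    have "(\<lambda>n. 2 * M * C / 2 ^ n) \<longlonglongrightarrow> 0"
      by (rule LIMSEQ_divide_realpow_zero) simp
    from order_tendstoD(2)[OF this that] show ?thesis by (simp add: field_simps)
  qed
  have "Cauchy (\<lambda>n. U n t)" for t
  proof (rule CauchyI')
    fix e :: real assume "e > 0"
    from small[OF this, of "E t"] obtain N where "\<forall>n\<ge>N. 2 * M / 2 ^ n * E t < e"
      unfolding eventually_sequentially by blast
    then have "norm (U m t - U n t) < e" if "N \<le> m" "m < n" for m n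
      using tail'[of m n t] that by (simp add: norm_minus_commute le_less_trans)
    then show "\<exists>N. \<forall>m\<ge>N. \<forall>n>m. dist (U m t) (U n t) < e"
      by (auto simp: dist_norm)
  qed
  then have "\<exists>l. (\<lambda>n. U n t) \<longlonglongrightarrow> l" for t
    by (simp add: Cauchy_convergent_iff convergent_def)
  then obtain u where u: "\<And>t. (\<lambda>n. U n t) \<longlonglongrightarrow> u t"
    using choice[of "\<lambda>t l. (\<lambda>n. U n t) \<longlonglongrightarrow> l"] by blast
  have u_bound: "norm (u t - U n t) \<le> 2 * M / 2 ^ n * E t" for n t
  proof (rule LIMSEQ_le_const2)
    show "(\<lambda>m. norm (U m t - U n t)) \<longlonglongrightarrow> norm (u t - U n t)"
      by (intro tendsto_intros u)
    show "\<exists>N. \<forall>m\<ge>N. norm (U m t - U n t) \<le> 2 * M / 2 ^ n * E t"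
      using tail' by blast
  qed
  have u_on: "continuous_on {- T<..<T} u" for T
  proof (rule uniform_limit_theorem)
    show "\<forall>\<^sub>F n in sequentially. continuous_on {- T<..<T} (U n)"
      using U_cont continuous_on_subset by (intro always_eventually allI) blast
    show "uniform_limit {- T<..<T} U u sequentially"
    proof (rule uniform_limitI)
      fix e :: real assume "e > 0"
      from small[OF this, of "exp (2 * K * T)"]
      show "\<forall>\<^sub>F n in sequentially. \<forall>t\<in>{- T<..<T}. dist (U n t) (u t) < e"
      proof eventually_elim
        case (elim n)
        show ?case
        proof
          fix t assume "t \<in> {- T<..<T}"
          then have "E t \<le> exp (2 * K * T)"
            using \<open>K > 0\<close> by (auto simp: E_def abs_le_iff)
          then have "2 * M / 2 ^ n * E t \<le> 2 * M / 2 ^ n * exp (2 * K * T)"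
            using \<open>M \<ge> 0\<close> by (intro mult_left_mono) auto
          then show "dist (U n t) (u t) < e"
            using u_bound[of t n] elim by (simp add: dist_norm norm_minus_commute)
        qed
      qed
    qed
  qed simp
  have "isCont u t" for t
  proof -
    have "t \<in> {- (\<bar>t\<bar> + 1)<..<\<bar>t\<bar> + 1}" by (auto simp: abs_if)
    then show ?thesis
      using u_on[of "\<bar>t\<bar> + 1"] continuous_on_eq_continuous_at[OF open_greaterThanLessThan] by blast
  qed
  then have u_cont: "continuous_on UNIV u"
    by (simp add: continuous_at_imp_continuous_on)
  have "P (\<lambda>t. G (u t)) t = u t" for t
  proof (rule LIMSEQ_unique)
    show "(\<lambda>n. U (Suc n) t) \<longlonglongrightarrow> u t"
      using u LIMSEQ_Suc by blast
    show "(\<lambda>n. U (Suc n) t) \<longlonglongrightarrow> P (\<lambda>t. G (u t)) t"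
    proof (rule LIM_zero_cancel, rule Lim_null_comparison)
      show "(\<lambda>n. (M * E t) / 2 ^ n) \<longlonglongrightarrow> 0"
        by (rule LIMSEQ_divide_realpow_zero) simp
      show "\<forall>\<^sub>F n in sequentially. norm (U (Suc n) t - P (\<lambda>t. G (u t)) t) \<le> M * E t / 2 ^ n"
      proof (rule always_eventually, rule allI)
        fix n
        have "norm (U (Suc n) t - P (\<lambda>t. G (u t)) t) \<le> M / 2 ^ n * exp (2 * K * \<bar>t\<bar>)"
        proof (rule norm_le_exp_of_deriv_norm_le[where f' = "\<lambda>t. G (U n t) - G (u t)"])
          show "((\<lambda>t. U (Suc n) t - P (\<lambda>t. G (u t)) t) has_vector_derivative G (U n t)
              - G (u t)) (at t)" for t
            by (intro derivative_intros U_der P(2) G_cont u_cont)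
          fix t
          have "norm (G (U n t) - G (u t)) \<le> K * norm (u t - U n t)"
            using GK[of "U n t" "u t"] by (simp add: norm_minus_commute)
          also have "\<dots> \<le> K * (2 * M / 2 ^ n * E t)"
            using u_bound \<open>K > 0\<close> by (intro mult_left_mono) auto
          finally show "norm (G (U n t) - G (u t)) \<le> M / 2 ^ n * (2 * K) * exp (2 * K * \<bar>t\<bar>)"
            by (simp add: E_def field_simps)
        qed (simp_all add: U_0 P(1)[OF G_cont[OF u_cont]] \<open>M \<ge> 0\<close>)
        then show "norm (U (Suc n) t - P (\<lambda>t. G (u t)) t) \<le> M * E t / 2 ^ n"
          by (simp add: E_def)
      qed
    qed
  qed
  then have "P (\<lambda>t. G (u t)) = u" by auto
  then have "global_solution G u" "u 0 = p"
    unfolding global_solution_def using P[OF G_cont[OF u_cont]] by metis+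
  then show ?thesis by blast
qed

text \<open>If \<open>\<bar>\<phi>'\<bar> \<le> K * \<phi>\<close>, then \<open>\<phi> * exp (- K * t)\<close> decreases and \<open>\<phi> * exp (K * t)\<close> increases; the
first gives the bound for the future, the second for the past.\<close>

lemma gronwall_two_sided:
  fixes \<phi> :: "real \<Rightarrow> real"
  assumes der: "\<And>t. (\<phi> has_real_derivative \<phi>' t) (at t)" and bound: "\<And>t. \<bar>\<phi>' t\<bar> \<le> K * \<phi> t"
  shows "\<phi> t \<le> \<phi> s * exp (K * \<bar>t - s\<bar>)"
proof (cases "s \<le> t")
  case True
  have "\<phi> s * exp (- K * s) \<ge> \<phi> t * exp (- K * t)"
  proof (rule DERIV_nonpos_imp_nonincreasing[OF True])
    fix x
    have "((\<lambda>t. \<phi> t * exp (- K * t)) has_real_derivative (\<phi>' x - K * \<phi> x) * exp (- K * x)) (at x)"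
      by (auto intro!: derivative_eq_intros der simp: algebra_simps)
    moreover have "(\<phi>' x - K * \<phi> x) * exp (- K * x) \<le> 0"
      using bound[of x] by (intro mult_nonpos_nonneg) auto
    ultimately show "\<exists>y. ((\<lambda>t. \<phi> t * exp (- K * t)) has_real_derivative y) (at x) \<and> y \<le> 0" by blast
  qed
  then have "\<phi> t * exp (- K * t) * exp (K * t) \<le> \<phi> s * exp (- K * s) * exp (K * t)"
    by (rule mult_right_mono) simp
  then show ?thesis
    using True by (simp add: mult.assoc exp_add[symmetric] algebra_simps)
next
  case False
  then have le: "t \<le> s" by simp
  have "\<phi> t * exp (K * t) \<le> \<phi> s * exp (K * s)"
  proof (rule DERIV_nonneg_imp_nondecreasing[OF le])
    fix x
    have "((\<lambda>t. \<phi> t * exp (K * t)) has_real_derivative (\<phi>' x + K * \<phi> x) * exp (K * x)) (at x)"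
      by (auto intro!: derivative_eq_intros der simp: algebra_simps)
    moreover have "(\<phi>' x + K * \<phi> x) * exp (K * x) \<ge> 0"
      using bound[of x] by (intro mult_nonneg_nonneg) auto
    ultimately show "\<exists>y. ((\<lambda>t. \<phi> t * exp (K * t)) has_real_derivative y) (at x) \<and> 0 \<le> y" by blast
  qed
  then have "\<phi> t * exp (K * t) * exp (- K * t) \<le> \<phi> s * exp (K * s) * exp (- K * t)"
    by (rule mult_right_mono) simp
  then show ?thesis
    using False by (simp add: mult.assoc exp_add[symmetric] algebra_simps)
qed

lemma lipschitz_global_solution_unique:
  fixes G :: "'a::real_inner \<Rightarrow> 'a"
  assumes G: "L-lipschitz_on UNIV G" and u: "global_solution G u" and v: "global_solution G v"
    and eq: "u s = v s"
  shows "u = v"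
proof
  fix t
  define \<phi> where "\<phi> t = (u t - v t) \<bullet> (u t - v t)" for t
  have der: "(\<phi> has_real_derivative 2 * ((u t - v t) \<bullet> (G (u t) - G (v t)))) (at t)" for t
  proof -
    have d: "((\<lambda>t. u t - v t) has_derivative (\<lambda>h. h *\<^sub>R (G (u t) - G (v t)))) (at t)"
      using u v unfolding global_solution_def has_vector_derivative_def
      by (auto intro!: derivative_eq_intros simp: algebra_simps)
    have "(\<phi> has_derivative (\<lambda>h. (u t - v t) \<bullet> (h *\<^sub>R (G (u t) - G (v t))) + (h *\<^sub>R (G (u t)
        - G (v t))) \<bullet> (u t - v t))) (at t)"
      unfolding \<phi>_def by (rule has_derivative_inner[OF d d])
    moreover have "(\<lambda>h. (u t - v t) \<bullet> (h *\<^sub>R (G (u t) - G (v t))) + (h *\<^sub>R (G (u t)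
        - G (v t))) \<bullet> (u t - v t))
        = (*) (2 * ((u t - v t) \<bullet> (G (u t) - G (v t))))"
    proof
      fix h
      show "(u t - v t) \<bullet> (h *\<^sub>R (G (u t) - G (v t))) + (h *\<^sub>R (G (u t) - G (v t))) \<bullet> (u t - v t)
          = 2 * ((u t - v t) \<bullet> (G (u t) - G (v t))) * h"
        by (subst inner_commute[of "h *\<^sub>R _"]) simp
    qed
    ultimately show ?thesis
      by (simp only: has_field_derivative_def)
  qed
  have "\<phi> t \<le> \<phi> s * exp (2 * L * \<bar>t - s\<bar>)"
  proof (rule gronwall_two_sided[OF der])
    fix t
    have "\<bar>(u t - v t) \<bullet> (G (u t) - G (v t))\<bar> \<le> norm (u t - v t) * norm (G (u t) - G (v t))"
      by (rule Cauchy_Schwarz_ineq2)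
    also have "\<dots> \<le> norm (u t - v t) * (L * norm (u t - v t))"
      by (intro mult_left_mono lipschitz_on_normD[OF G]) auto
    also have "\<dots> = L * \<phi> t" by (simp add: \<phi>_def dot_square_norm power2_eq_square)
    finally show "\<bar>2 * ((u t - v t) \<bullet> (G (u t) - G (v t)))\<bar> \<le> 2 * L * \<phi> t" by simp
  qed
  then have "\<phi> t \<le> 0" by (simp add: \<phi>_def eq)
  moreover have "\<phi> t \<ge> 0" by (simp add: \<phi>_def)
  ultimately have "\<phi> t = 0" by simp
  then show "u t = v t" by (simp add: \<phi>_def)
qed

section \<open>Centers of reversible perturbations of the rotation\<close>

text \<open>Composing with this retraction of the line onto \<open>[-\<rho>, \<rho>]\<close> in both variables turns a
polynomial field into a globally Lipschitz one without changing it near the origin. It is odd, so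
the symmetry in \<open>y\<close> survives.\<close>

definition clamp_to :: "real \<Rightarrow> real \<Rightarrow> real" where
  "clamp_to \<rho> x = max (- \<rho>) (min \<rho> x)"

lemma clamp_to_eq: "\<bar>x\<bar> \<le> \<rho> \<Longrightarrow> clamp_to \<rho> x = x"
  by (auto simp: clamp_to_def)

lemma clamp_to_minus: "0 \<le> \<rho> \<Longrightarrow> clamp_to \<rho> (- x) = - clamp_to \<rho> x"
  by (auto simp: clamp_to_def max_def min_def)

lemma abs_clamp_to_le: "0 \<le> \<rho> \<Longrightarrow> \<bar>clamp_to \<rho> x\<bar> \<le> \<bar>x\<bar>" "0 \<le> \<rho> \<Longrightarrow> \<bar>clamp_to \<rho> x\<bar> \<le> \<rho>"
  by (auto simp: clamp_to_def max_def min_def)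

lemma lipschitz_clamp_to: "\<bar>clamp_to \<rho> x - clamp_to \<rho> y\<bar> \<le> \<bar>x - y\<bar>"
  by (auto simp: clamp_to_def max_def min_def)

lemma planar_solution_iff:
  "global_solution (\<lambda>(x, y). (y, f x y)) u \<longleftrightarrow>
    (\<forall>t. ((\<lambda>t. fst (u t)) has_real_derivative snd (u t)) (at t) \<and>
         ((\<lambda>t. snd (u t)) has_real_derivative f (fst (u t)) (snd (u t))) (at t))"
proof
  assume u: "global_solution (\<lambda>(x, y). (y, f x y)) u"
  have d: "(u has_vector_derivative (snd (u t), f (fst (u t)) (snd (u t)))) (at t)" for t
    using u by (simp add: global_solution_def case_prod_beta)
  show "\<forall>t. ((\<lambda>t. fst (u t)) has_real_derivative snd (u t)) (at t) \<and>
         ((\<lambda>t. snd (u t)) has_real_derivative f (fst (u t)) (snd (u t))) (at t)"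
    using bounded_linear.has_vector_derivative[OF bounded_linear_fst d]
      bounded_linear.has_vector_derivative[OF bounded_linear_snd d]
    by (simp add: has_real_derivative_iff_has_vector_derivative)
next
  assume "\<forall>t. ((\<lambda>t. fst (u t)) has_real_derivative snd (u t)) (at t) \<and>
         ((\<lambda>t. snd (u t)) has_real_derivative f (fst (u t)) (snd (u t))) (at t)"
  then have "((\<lambda>t. (fst (u t), snd (u t))) has_vector_derivative (snd (u t),
      f (fst (u t)) (snd (u t)))) (at t)" for t
    unfolding has_real_derivative_iff_has_vector_derivative
    by (intro has_vector_derivative_Pair) auto
  then show "global_solution (\<lambda>(x, y). (y, f x y)) u"
    by (simp add: global_solution_def case_prod_beta)
qed

lemma abs_fst_le_norm: "\<bar>fst z\<bar> \<le> norm z" for z :: "real \<times> real"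
  by (metis norm_fst_le prod.collapse real_norm_def)

lemma abs_snd_le_norm: "\<bar>snd z\<bar> \<le> norm z" for z :: "real \<times> real"
  by (metis norm_snd_le prod.collapse real_norm_def)

text \<open>For a perturbation \<open>n\<close> of relative size at most 1/200 the norm grows by less than a factor
two within time 22, so the solution written in the rotating frame, \<open>(A, B)\<close> in the proof, moves by
at most 11/50 of the initial norm in each component. The time 22 exceeds \<open>11 / 2 * pi\<close>: the first
two zeros of \<open>snd (u t)\<close> around a phase below \<open>2 * pi\<close>, and one full period after the first of
them, lie before it.\<close>

lemma solution_rotates:
  fixes u :: "real \<Rightarrow> real \<times> real"
  assumes x': "\<And>t. ((\<lambda>t. fst (u t)) has_real_derivative snd (u t)) (at t)"
    and y': "\<And>t. ((\<lambda>t. snd (u t)) has_real_derivative - fst (u t) + n t) (at t)"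
    and n: "\<And>t. \<bar>n t\<bar> \<le> norm (u t) / 200" and t: "\<bar>t\<bar> \<le> 22"
  shows "norm (u t) \<le> 2 * norm (u 0)"
    and "\<bar>snd (u t) - (snd (u 0) * cos t - fst (u 0) * sin t)\<bar> \<le> 11 / 25 * norm (u 0)"
proof -
  define r where "r = norm (u 0)"
  define x where "x t = fst (u t)" for t
  define y where "y t = snd (u t)" for t
  have "r \<ge> 0" by (simp add: r_def)
  have norm_sq: "(norm (u t))^2 = (x t)^2 + (y t)^2" for t
    by (simp add: x_def y_def norm_prod_def)
  have bound: "norm (u t) \<le> 2 * r" if "\<bar>t\<bar> \<le> 22" for t
  proof -
    have "(norm (u t))^2 \<le> (norm (u 0))^2 * exp (1 / 100 * \<bar>t - 0\<bar>)"
    proof (rule gronwall_two_sided[where \<phi>' = "\<lambda>t. 2 * (y t * n t)"])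
      fix t
      show "((\<lambda>t. (norm (u t))^2) has_real_derivative 2 * (y t * n t)) (at t)"
        unfolding norm_sq x_def y_def
        by (auto intro!: derivative_eq_intros x' y' simp: algebra_simps)
      have "\<bar>y t\<bar> * \<bar>n t\<bar> \<le> norm (u t) * (norm (u t) / 200)"
        using n abs_snd_le_norm[of "u t"] by (intro mult_mono) (auto simp: y_def)
      then show "\<bar>2 * (y t * n t)\<bar> \<le> 1 / 100 * (norm (u t))^2"
        by (simp add: abs_mult power2_eq_square)
    qed
    also have "\<dots> \<le> r^2 * exp 1"
      using that unfolding r_def by (intro mult_left_mono) auto
    also have "\<dots> \<le> r^2 * 4"
      using exp_le by (intro mult_left_mono) auto
    also have "\<dots> = (2 * r)^2" by (simp add: power2_eq_square)
    finally show ?thesis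
      by (rule power2_le_imp_le) (use \<open>r \<ge> 0\<close> in simp)
  qed
  show "norm (u t) \<le> 2 * norm (u 0)"
    using bound[OF t] by (simp add: r_def)
  have drift: "\<bar>f t - f 0\<bar> \<le> 11 / 50 * r"
    if f: "\<And>t. (f has_real_derivative n t * g t) (at t)" and g: "\<And>t. \<bar>g t\<bar> \<le> 1" for f g
  proof -
    have "norm (f t - f 0) \<le> r / 100 * norm (t - 0)"
    proof (rule field_differentiable_bound[where S = "{-22..22}" and f' = "\<lambda>t. n t * g t"])
      fix s :: real assume s: "s \<in> {-22..22}"
      show "(f has_real_derivative n s * g s) (at s within {-22..22})"
        using f by (rule has_field_derivative_at_within)
      have "\<bar>n s\<bar> \<le> r / 100"
        using n[of s] bound[of s] s by (auto simp: abs_le_iff)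
      then have "\<bar>n s\<bar> * \<bar>g s\<bar> \<le> r / 100 * 1"
        using \<open>r \<ge> 0\<close> by (intro mult_mono g) auto
      then show "norm (n s * g s) \<le> r / 100" by (simp add: abs_mult)
    qed (use t in auto)
    also have "\<dots> \<le> r / 100 * 22"
      using t \<open>r \<ge> 0\<close> by (intro mult_left_mono) auto
    finally show ?thesis by simp
  qed
  define A where "A = (\<lambda>t. x t * cos t - y t * sin t)"
  define B where "B = (\<lambda>t. x t * sin t + y t * cos t)"
  have A: "\<bar>A t - A 0\<bar> \<le> 11 / 50 * r"
  proof (rule drift)
    show "(A has_real_derivative n t * (- sin t)) (at t)" for t
      unfolding A_def x_def y_def
      by (auto intro!: derivative_eq_intros x' y' simp: algebra_simps)
  qed simp
  have B: "\<bar>B t - B 0\<bar> \<le> 11 / 50 * r"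
  proof (rule drift)
    show "(B has_real_derivative n t * cos t) (at t)" for t
      unfolding B_def x_def y_def
      by (auto intro!: derivative_eq_intros x' y' simp: algebra_simps)
  qed simp
  have eq: "snd (u t) - (snd (u 0) * cos t - fst (u 0) * sin t)
      = (B t - B 0) * cos t - (A t - A 0) * sin t"
  proof -
    have "y t = y t * ((cos t)^2 + (sin t)^2)" by simp
    also have "\<dots> = B t * cos t - A t * sin t"
      unfolding A_def B_def by algebra
    finally show ?thesis
      by (simp add: A_def B_def x_def y_def algebra_simps)
  qed
  have "\<bar>(B t - B 0) * cos t\<bar> \<le> \<bar>B t - B 0\<bar>" "\<bar>(A t - A 0) * sin t\<bar> \<le> \<bar>A t - A 0\<bar>"
    using abs_cos_le_one[of t] abs_sin_le_one[of t] by (simp_all add: abs_mult mult_left_le)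
  then have "\<bar>(B t - B 0) * cos t\<bar> + \<bar>(A t - A 0) * sin t\<bar> \<le> 11 / 50 * r + 11 / 50 * r"
    using A B by (intro add_mono) auto
  then show "\<bar>snd (u t) - (snd (u 0) * cos t - fst (u 0) * sin t)\<bar> \<le> 11 / 25 * norm (u 0)"
    unfolding eq
    using abs_triangle_ineq4[of "(B t - B 0) * cos t" "(A t - A 0) * sin t"] by (simp add: r_def)
qed

text \<open>Let \<open>u\<close> solve the clamped system and let \<open>snd (u s) = 0\<close>. The reflected curve \<open>t \<mapsto> (fst (u
(2 * s - t)), - snd (u (2 * s - t)))\<close> solves the same system and agrees with \<open>u\<close> at \<open>s\<close>, so it is
\<open>u\<close>. Two such zeros exist because \<open>snd (u t)\<close> stays close to \<open>r * sin (\<alpha> - t)\<close>, which takes the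
values \<open>r\<close>, \<open>- r\<close>, \<open>r\<close> at intervals of half a turn. One period lies in the time window in which
the solution is known to be small, and by periodicity it is small always, so clamping has no
effect on it.\<close>

lemma reversible_center:
  fixes g :: "real \<Rightarrow> real \<Rightarrow> real"
  assumes even: "\<And>x y. g x (- y) = g x y"
    and lip: "\<And>\<rho>. 0 < \<rho> \<Longrightarrow> \<exists>L. L-lipschitz_on UNIV (\<lambda>(x, y). g (clamp_to \<rho> x) (clamp_to \<rho> y))"
    and small: "\<And>e. 0 < e \<Longrightarrow> \<exists>\<rho>>0. \<forall>x y. \<bar>x\<bar> \<le> \<rho> \<longrightarrow> \<bar>y\<bar> \<le> \<rho> \<longrightarrow> \<bar>g x y\<bar> \<le> e * norm (x, y)"
  shows "center (\<lambda>(x, y). (y, - x + g x y)) (0, 0)"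
proof -
  let ?F = "\<lambda>(x, y). (y, - x + g x y)"
  have "0 < (1 / 200 :: real)" by simp
  from small[OF this] obtain \<rho> where "\<rho> > 0"
    and g_small: "\<And>x y. \<bar>x\<bar> \<le> \<rho> \<Longrightarrow> \<bar>y\<bar> \<le> \<rho> \<Longrightarrow> \<bar>g x y\<bar> \<le> 1 / 200 * norm (x, y)"
    by blast
  define gc where "gc x y = g (clamp_to \<rho> x) (clamp_to \<rho> y)" for x y
  let ?G = "\<lambda>(x, y). (y, - x + gc x y)"
  obtain L where "L-lipschitz_on UNIV (\<lambda>(x, y). gc x y)"
    using lip[OF \<open>\<rho> > 0\<close>] by (auto simp: gc_def)
  moreover have "1-lipschitz_on UNIV (\<lambda>z :: real \<times> real. fst z)"
    by (rule lipschitz_onI) (simp_all add: dist_fst_le)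
  moreover have "1-lipschitz_on UNIV (\<lambda>z :: real \<times> real. snd z)"
    by (rule lipschitz_onI) (simp_all add: dist_snd_le)
  ultimately have "(sqrt (1\<^sup>2 + (1 + L)\<^sup>2))-lipschitz_on UNIV (\<lambda>z. (snd z, - fst z
      + (\<lambda>(x, y). gc x y) z))"
    by (intro lipschitz_on_Pair lipschitz_on_add lipschitz_on_minus)
  then obtain C where G_lip: "C-lipschitz_on UNIV ?G"
    by (auto simp: case_prod_beta)
  have gc_small: "\<bar>gc x y\<bar> \<le> norm (x, y) / 200" for x y
  proof -
    have "\<bar>gc x y\<bar> \<le> 1 / 200 * norm (clamp_to \<rho> x, clamp_to \<rho> y)"
      unfolding gc_def using abs_clamp_to_le(2) \<open>\<rho> > 0\<close> by (intro g_small) auto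
    also have "norm (clamp_to \<rho> x, clamp_to \<rho> y) \<le> norm (x, y)"
    proof -
      have "(clamp_to \<rho> z)\<^sup>2 \<le> z\<^sup>2" for z
        using abs_clamp_to_le(1)[of \<rho> z] \<open>\<rho> > 0\<close> by (simp add: abs_le_square_iff)
      from add_mono[OF this[of x] this[of y]] show ?thesis
        by (simp add: norm_prod_def)
    qed
    finally show ?thesis by simp
  qed
  have orbit: "\<exists>\<Gamma>. periodic_orbit ?F \<Gamma> \<and> q \<in> \<Gamma>" if q: "norm q < \<rho> / 2" "q \<noteq> 0" for q :: "real \<times> real"
  proof -
    obtain u where u: "global_solution ?G u" and u0: "u 0 = q"
      using lipschitz_global_solution_exists[OF G_lip] by blast
    define r where "r = norm q"
    have "r > 0" using q by (simp add: r_def)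
    have x': "((\<lambda>t. fst (u t)) has_real_derivative snd (u t)) (at t)"
      and y': "((\<lambda>t. snd (u t)) has_real_derivative - fst (u t)
          + gc (fst (u t)) (snd (u t))) (at t)" for t
      using u by (simp_all add: planar_solution_iff)
    have gcu: "\<bar>gc (fst (u t)) (snd (u t))\<bar> \<le> norm (u t) / 200" for t
      using gc_small[of "fst (u t)" "snd (u t)"] by simp
    note rot = solution_rotates[OF x' y' gcu, unfolded u0, folded r_def]
    have "(fst q / r)\<^sup>2 + (snd q / r)\<^sup>2 = 1"
    proof -
      have "r\<^sup>2 = (fst q)\<^sup>2 + (snd q)\<^sup>2" by (simp add: r_def norm_prod_def)
      moreover have "(fst q / r)\<^sup>2 + (snd q / r)\<^sup>2 = ((fst q)\<^sup>2 + (snd q)\<^sup>2) / r\<^sup>2"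
        by (simp add: power_divide add_divide_distrib)
      ultimately show ?thesis using \<open>r > 0\<close> by (metis divide_self less_irrefl zero_eq_power2)
    qed
    then obtain \<alpha> where \<alpha>: "0 \<le> \<alpha>" "\<alpha> < 2 * pi" "fst q / r = cos \<alpha>" "snd q / r = sin \<alpha>"
      by (rule sincos_total_2pi) blast
    have near: "\<bar>snd (u t) - r * sin (\<alpha> - t)\<bar> \<le> 11 / 25 * r" if "\<bar>t\<bar> \<le> 22" for t
    proof -
      have "fst q = r * cos \<alpha>" "snd q = r * sin \<alpha>"
        using \<alpha> \<open>r > 0\<close> by (simp_all add: field_simps)
      then show ?thesis
        using rot(2)[OF that] by (simp add: sin_diff algebra_simps)
    qed
    have pi: "3 < pi" "pi < 4" using pi_gt3 pi_less_4 by auto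
    have y_pos: "snd (u (\<alpha> - pi / 2)) > 0"
    proof -
      have "\<bar>\<alpha> - pi / 2\<bar> \<le> 22" using \<alpha>(1,2) pi by linarith
      from near[OF this] have "\<bar>snd (u (\<alpha> - pi / 2)) - r\<bar> \<le> 11 / 25 * r" by simp
      then show ?thesis using \<open>r > 0\<close> by linarith
    qed
    have y_neg: "snd (u (\<alpha> + pi / 2)) < 0"
    proof -
      have "\<bar>\<alpha> + pi / 2\<bar> \<le> 22" using \<alpha>(1,2) pi by linarith
      from near[OF this] have "\<bar>snd (u (\<alpha> + pi / 2)) + r\<bar> \<le> 11 / 25 * r" by simp
      then show ?thesis using \<open>r > 0\<close> by linarith
    qed
    have y_pos': "snd (u (\<alpha> + 3 / 2 * pi)) > 0"
    proof -
      have "\<bar>\<alpha> + 3 / 2 * pi\<bar> \<le> 22" using \<alpha>(1,2) pi by linarith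
      moreover have "sin (\<alpha> - (\<alpha> + 3 / 2 * pi)) = 1"
      proof -
        have "\<alpha> - (\<alpha> + 3 / 2 * pi) = - (3 / 2 * pi)" by simp
        then show ?thesis by (simp only: sin_minus sin_3over2_pi minus_minus)
      qed
      ultimately have "\<bar>snd (u (\<alpha> + 3 / 2 * pi)) - r\<bar> \<le> 11 / 25 * r"
        using near[of "\<alpha> + 3 / 2 * pi"] by simp
      then show ?thesis using \<open>r > 0\<close> by linarith
    qed
    have y_cont: "continuous_on S (\<lambda>t. snd (u t))" for S
      by (intro continuous_at_imp_continuous_on ballI DERIV_isCont[OF y'])
    have "\<exists>t\<ge>\<alpha> - pi / 2. t \<le> \<alpha> + pi / 2 \<and> snd (u t) = 0"
      by (rule IVT2') (use y_pos y_neg pi y_cont in auto)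
    then obtain t1 where t1: "\<alpha> - pi / 2 \<le> t1" "t1 \<le> \<alpha> + pi / 2" "snd (u t1) = 0"
      by blast
    have "\<exists>t\<ge>\<alpha> + pi / 2. t \<le> \<alpha> + 3 / 2 * pi \<and> snd (u t) = 0"
      by (rule IVT') (use y_pos' y_neg pi y_cont in auto)
    then obtain t2 where t2: "\<alpha> + pi / 2 \<le> t2" "t2 \<le> \<alpha> + 3 / 2 * pi" "snd (u t2) = 0"
      by blast
    have "t1 \<noteq> \<alpha> + pi / 2" using t1(3) y_neg by auto
    then have "t1 < t2" using t1 t2 by linarith
    have reflect: "u (2 * s - t) = (fst (u t), - snd (u t))" if "snd (u s) = 0" for s t
    proof -
      define v where "v t = (fst (u (2 * s - t)), - snd (u (2 * s - t)))" for t
      have "global_solution ?G v"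
        unfolding planar_solution_iff
      proof (intro allI conjI)
        fix t
        have "((\<lambda>t. fst (u (2 * s - t))) has_real_derivative snd (u (2 * s - t)) * (- 1)) (at t)"
          by (rule DERIV_chain2[OF x']) (auto intro!: derivative_eq_intros)
        then show "((\<lambda>t. fst (v t)) has_real_derivative snd (v t)) (at t)"
          by (simp add: v_def)
        have "((\<lambda>t. snd (u (2 * s - t))) has_real_derivative
            (- fst (u (2 * s - t)) + gc (fst (u (2 * s - t))) (snd (u (2 * s
                - t)))) * (- 1)) (at t)"
          by (rule DERIV_chain2[OF y']) (auto intro!: derivative_eq_intros)
        from DERIV_minus[OF this]
        show "((\<lambda>t. snd (v t)) has_real_derivative - fst (v t) + gc (fst (v t)) (snd (v t))) (at t)"
          using \<open>\<rho> > 0\<close> by (simp add: v_def gc_def clamp_to_minus even)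
      qed
      moreover have "v s = u s"
        using that by (simp add: v_def prod_eq_iff)
      ultimately have "v = u"
        by (rule lipschitz_global_solution_unique[OF G_lip _ u])
      then have "u (2 * s - t) = v (2 * s - t)" by simp
      then show ?thesis by (simp add: v_def)
    qed
    define T where "T = 2 * (t2 - t1)"
    have "T > 0" using \<open>t1 < t2\<close> by (simp add: T_def)
    have period: "u (t + T) = u t" for t
    proof -
      have "t + T = 2 * t2 - (2 * t1 - t)" by (simp add: T_def)
      then have "u (t + T) = u (2 * t2 - (2 * t1 - t))" by (rule arg_cong)
      also have "\<dots> = u t"
        by (simp only: reflect[OF t2(3), of "2 * t1 - t"] reflect[OF t1(3), of t])
          (simp add: prod_eq_iff)
      finally show ?thesis .
    qed
    interpret u: periodic_fun_simple u T
      by unfold_locales (rule period)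
    have u_small: "norm (u t) \<le> \<rho>" for t
    proof -
      define k where "k = \<lfloor>(t - t1) / T\<rfloor>"
      define t' where "t' = t - of_int k * T"
      have "of_int k \<le> (t - t1) / T" "(t - t1) / T < of_int k + 1"
        by (simp_all add: k_def floor_correct)
      then have "t1 \<le> t'" and "t' < t1 + T"
        using \<open>T > 0\<close> by (simp_all add: t'_def field_simps)
      have "t' \<le> 22"
      proof -
        have "t1 + T = 2 * t2 - t1" by (simp add: T_def)
        then show ?thesis
          using \<open>t' < t1 + T\<close> t1(1) t2(2) \<alpha>(2) pi by linarith
      qed
      moreover have "- 22 \<le> t'"
        using \<open>t1 \<le> t'\<close> t1(1) \<alpha>(1) pi by linarith
      ultimately have "\<bar>t'\<bar> \<le> 22" by linarith
      moreover have "u t = u t'"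
        using u.plus_of_int[of t' k] by (simp add: t'_def)
      ultimately show ?thesis
        using rot(1)[of t'] q(1) by (simp add: r_def)
    qed
    have "gc (fst (u t)) (snd (u t)) = g (fst (u t)) (snd (u t))" for t
      unfolding gc_def
      using clamp_to_eq[OF order_trans[OF abs_fst_le_norm u_small]]
        clamp_to_eq[OF order_trans[OF abs_snd_le_norm u_small]] by simp
    then have "global_solution ?F u"
      using u by (simp add: planar_solution_iff)
    moreover have "\<not> u constant_on UNIV"
    proof
      assume "u constant_on UNIV"
      then obtain z where "\<And>t. u t = z" by (auto simp: constant_on_def)
      then show False using t1(3) y_pos by simp
    qed
    ultimately have "periodic_orbit ?F (range u)"
      unfolding periodic_orbit_def using \<open>T > 0\<close> period by blast
    moreover have "q \<in> range u" using u0 by blast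
    ultimately show ?thesis by blast
  qed
  have "\<bar>g 0 0\<bar> \<le> 1 / 200 * norm (0 :: real, 0 :: real)"
    using \<open>\<rho> > 0\<close> by (intro g_small) auto
  then have "equilibrium_point ?F (0, 0)"
    by (simp add: equilibrium_point_def zero_prod_def)
  moreover have zero: "(0, 0) = (0 :: real \<times> real)"
    by (simp add: zero_prod_def)
  moreover have "0 \<in> interior (ball 0 (\<rho> / 2) :: (real \<times> real) set)"
    using \<open>\<rho> > 0\<close> by simp
  moreover have "\<exists>\<Gamma>. periodic_orbit ?F \<Gamma> \<and> q \<in> \<Gamma>" if "q \<in> ball 0 (\<rho> / 2) - {0}" for q
    using orbit[of q] that by simp
  ultimately show ?thesis
    unfolding center_def zero by blast
qed

text \<open>A product of Lipschitz functions need not be Lipschitz unless the factors are bounded; the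
conjunction is closed under sums and products and so passes from clamped coordinates to clamped
polynomials.\<close>

definition bounded_lipschitz :: "('a::metric_space \<Rightarrow> real) \<Rightarrow> bool" where
  "bounded_lipschitz f \<longleftrightarrow> (\<exists>B. \<forall>x. \<bar>f x\<bar> \<le> B) \<and> (\<exists>L. L-lipschitz_on UNIV f)"

lemma bounded_lipschitz_const: "bounded_lipschitz (\<lambda>_. c)"
  unfolding bounded_lipschitz_def by (auto intro: lipschitz_on_constant)

lemma bounded_lipschitz_add:
  assumes "bounded_lipschitz f" "bounded_lipschitz g"
  shows "bounded_lipschitz (\<lambda>x. f x + g x)"
proof -
  obtain A B K L where f: "\<And>x. \<bar>f x\<bar> \<le> A" "K-lipschitz_on UNIV f"
    and g: "\<And>x. \<bar>g x\<bar> \<le> B" "L-lipschitz_on UNIV g"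
    using assms unfolding bounded_lipschitz_def by blast
  have "\<bar>f x + g x\<bar> \<le> A + B" for x
    using f(1)[of x] g(1)[of x] by linarith
  then show ?thesis
    using lipschitz_on_add[OF f(2) g(2)] unfolding bounded_lipschitz_def by blast
qed

lemma bounded_lipschitz_mult:
  assumes "bounded_lipschitz f" "bounded_lipschitz g"
  shows "bounded_lipschitz (\<lambda>x. f x * g x)"
proof -
  obtain A B K L where f: "\<And>x. \<bar>f x\<bar> \<le> A" "K-lipschitz_on UNIV f"
    and g: "\<And>x. \<bar>g x\<bar> \<le> B" "L-lipschitz_on UNIV g"
    using assms unfolding bounded_lipschitz_def by blast
  have "0 \<le> A" "0 \<le> B" using f(1) g(1) by (meson abs_ge_zero order_trans)+
  have "\<bar>f x * g x\<bar> \<le> A * B" for x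
    unfolding abs_mult using f(1) g(1) \<open>0 \<le> A\<close> by (intro mult_mono) auto
  moreover have "(A * L + B * K)-lipschitz_on UNIV (\<lambda>x. f x * g x)"
  proof (rule lipschitz_onI)
    fix x y
    have "\<bar>f x\<bar> * \<bar>g x - g y\<bar> \<le> A * (L * dist x y)"
      using f(1) \<open>0 \<le> A\<close> lipschitz_onD[OF g(2), of x y]
      by (intro mult_mono) (auto simp: dist_real_def)
    moreover have "\<bar>f x - f y\<bar> * \<bar>g y\<bar> \<le> K * dist x y * B"
      using g(1) lipschitz_onD[OF f(2), of x y] lipschitz_on_nonneg[OF f(2)]
      by (intro mult_mono) (auto simp: dist_real_def)
    moreover have "f x * g x - f y * g y = f x * (g x - g y) + (f x - f y) * g y"
      by (simp add: algebra_simps)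
    moreover have "\<bar>f x * (g x - g y) + (f x - f y) * g y\<bar>
        \<le> \<bar>f x\<bar> * \<bar>g x - g y\<bar> + \<bar>f x - f y\<bar> * \<bar>g y\<bar>"
      unfolding abs_mult[symmetric] by (rule abs_triangle_ineq)
    ultimately show "dist (f x * g x) (f y * g y) \<le> (A * L + B * K) * dist x y"
      by (simp add: dist_real_def algebra_simps)
  next
    show "0 \<le> A * L + B * K"
      using \<open>0 \<le> A\<close> \<open>0 \<le> B\<close> lipschitz_on_nonneg[OF f(2)] lipschitz_on_nonneg[OF g(2)] by simp
  qed
  ultimately show ?thesis unfolding bounded_lipschitz_def by blast
qed

lemma bounded_lipschitz_power:
  "bounded_lipschitz f \<Longrightarrow> bounded_lipschitz (\<lambda>x. f x ^ n)"
  by (induction n) (auto intro: bounded_lipschitz_const bounded_lipschitz_mult)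

lemma bounded_lipschitz_clamp:
  assumes "0 < \<rho>"
  shows "bounded_lipschitz (\<lambda>z :: real \<times> real. clamp_to \<rho> (fst z))"
    and "bounded_lipschitz (\<lambda>z :: real \<times> real. clamp_to \<rho> (snd z))"
proof -
  have "1-lipschitz_on UNIV (\<lambda>z :: real \<times> real. clamp_to \<rho> (fst z))"
  proof (rule lipschitz_onI)
    fix x y :: "real \<times> real"
    show "dist (clamp_to \<rho> (fst x)) (clamp_to \<rho> (fst y)) \<le> 1 * dist x y"
      using lipschitz_clamp_to[of \<rho> "fst x" "fst y"] dist_fst_le[of x y]
      by (simp add: dist_real_def)
  qed simp
  moreover have "1-lipschitz_on UNIV (\<lambda>z :: real \<times> real. clamp_to \<rho> (snd z))"
  proof (rule lipschitz_onI)
    fix x y :: "real \<times> real"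
    show "dist (clamp_to \<rho> (snd x)) (clamp_to \<rho> (snd y)) \<le> 1 * dist x y"
      using lipschitz_clamp_to[of \<rho> "snd x" "snd y"] dist_snd_le[of x y]
      by (simp add: dist_real_def)
  qed simp
  moreover have "\<bar>clamp_to \<rho> x\<bar> \<le> \<rho>" for x
    using assms by (intro abs_clamp_to_le) simp
  ultimately show "bounded_lipschitz (\<lambda>z :: real \<times> real. clamp_to \<rho> (fst z))"
    "bounded_lipschitz (\<lambda>z :: real \<times> real. clamp_to \<rho> (snd z))"
    unfolding bounded_lipschitz_def by blast+
qed

text \<open>Without the terms odd in \<open>y\<close> the nonlinearity is \<open>x\<close> times a quartic form that is even in
\<open>y\<close>, which is both the symmetry and the smallness that reversibility needs.\<close>

lemma quintic_center:
  "center (quintic_field 0 a14 0 a32 0 a50) (0, 0)"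
proof -
  define g where "g x y = a14 * x * y^4 + a32 * x^3 * y^2 + a50 * x^5" for x y :: real
  have "quintic_field 0 a14 0 a32 0 a50 = (\<lambda>(x, y). (y, - x + g x y))"
    by (simp add: quintic_field_def g_def fun_eq_iff algebra_simps)
  moreover have "center (\<lambda>(x, y). (y, - x + g x y)) (0, 0)"
  proof (rule reversible_center)
    show "g x (- y) = g x y" for x y by (simp add: g_def)
    show "\<exists>L. L-lipschitz_on UNIV (\<lambda>(x, y). g (clamp_to \<rho> x) (clamp_to \<rho> y))" if "0 < \<rho>" for \<rho>
    proof -
      have "bounded_lipschitz (\<lambda>z. g (clamp_to \<rho> (fst z)) (clamp_to \<rho> (snd z)))"
        unfolding g_def
        by (intro bounded_lipschitz_add bounded_lipschitz_mult bounded_lipschitz_power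
            bounded_lipschitz_const bounded_lipschitz_clamp that)
      then show ?thesis
        by (simp add: bounded_lipschitz_def case_prod_beta)
    qed
    show "\<exists>\<rho>>0. \<forall>x y. \<bar>x\<bar> \<le> \<rho> \<longrightarrow> \<bar>y\<bar> \<le> \<rho> \<longrightarrow> \<bar>g x y\<bar> \<le> e * norm (x, y)" if "0 < e" for e
    proof -
      define C where "C = \<bar>a14\<bar> + \<bar>a32\<bar> + \<bar>a50\<bar> + 1"
      define \<rho> where "\<rho> = min 1 (e / C)"
      have "C > 0" by (simp add: C_def add_nonneg_pos)
      then have "\<rho> > 0" "\<rho> \<le> 1" "C * \<rho> \<le> e"
        using that by (auto simp: \<rho>_def min_def field_simps)
      have "\<bar>g x y\<bar> \<le> e * norm (x, y)" if x: "\<bar>x\<bar> \<le> \<rho>" and y: "\<bar>y\<bar> \<le> \<rho>" for x y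
      proof -
        have pow: "\<bar>x\<bar>^i * \<bar>y\<bar>^j \<le> \<rho>" if "i + j = 4" for i j
        proof -
          have "\<bar>x\<bar>^i * \<bar>y\<bar>^j \<le> \<rho>^i * \<rho>^j"
            using x y by (intro mult_mono power_mono) auto
          also have "\<dots> = \<rho>^4" using that by (simp add: power_add[symmetric])
          also have "\<dots> \<le> \<rho>^1" using \<open>\<rho> > 0\<close> \<open>\<rho> \<le> 1\<close> by (intro power_decreasing) auto
          finally show ?thesis by simp
        qed
        define P where "P = a14 * y^4 + a32 * (x^2 * y^2) + a50 * x^4"
        have "\<bar>P\<bar> \<le> \<bar>a14\<bar> * (\<bar>x\<bar>^0 * \<bar>y\<bar>^4) + \<bar>a32\<bar> * (\<bar>x\<bar>^2 * \<bar>y\<bar>^2) + \<bar>a50\<bar> * (\<bar>x\<bar>^4 * \<bar>y\<bar>^0)"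
          unfolding P_def
          by (rule order_trans[OF abs_triangle_ineq add_mono[OF order_trans[OF abs_triangle_ineq]]])
            (simp_all add: abs_mult power_abs)
        also have "\<dots> \<le> \<bar>a14\<bar> * \<rho> + \<bar>a32\<bar> * \<rho> + \<bar>a50\<bar> * \<rho>"
          by (intro add_mono mult_left_mono pow) auto
        also have "\<dots> \<le> C * \<rho>" using \<open>\<rho> > 0\<close> by (simp add: C_def algebra_simps)
        also have "\<dots> \<le> e" by fact
        finally have "\<bar>P\<bar> \<le> e" .
        then have "\<bar>P\<bar> * \<bar>x\<bar> \<le> e * norm (x, y)"
          using abs_fst_le_norm[of "(x, y)"] \<open>0 < e\<close> by (intro mult_mono) auto
        moreover have "g x y = P * x" unfolding g_def P_def by algebra
        ultimately show ?thesis by (simp add: abs_mult)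
      qed
      then show ?thesis using \<open>\<rho> > 0\<close> by blast
    qed
  qed
  ultimately show ?thesis by simp
qed

section \<open>The first integral equation on coefficient sequences\<close>

text \<open>A binary form of degree \<open>n\<close> is stored as the sequence of its coefficients, \<open>c i\<close> belonging
to \<open>x ^ i * y ^ (n - i)\<close>. On coefficients, this is the derivative \<open>y * d/dx - x * d/dy\<close> along the
linear rotation.\<close>

definition rot :: "nat \<Rightarrow> (nat \<Rightarrow> real) \<Rightarrow> nat \<Rightarrow> real" where
  "rot n c i = (if i < n then real (i + 1) * c (i + 1) else 0)
             - (if i = 0 then 0 else real (n + 1 - i) * c (i - 1))"

text \<open>The derivative along the nonlinear part: \<open>c\<close> is mapped to \<open>Q * dc/dy\<close>, a form of degree \<open>n +
4\<close>, where \<open>Q = (\<Sum>j\<le>5. a j * x ^ j * y ^ (5 - j))\<close>. The truncated subtraction \<open>n - (i - j)\<close> makes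
coefficients beyond the degree irrelevant.\<close>

definition push :: "(nat \<Rightarrow> real) \<Rightarrow> nat \<Rightarrow> (nat \<Rightarrow> real) \<Rightarrow> nat \<Rightarrow> real" where
  "push a n c i = (\<Sum>j\<le>5. if j \<le> i then a j * real (n - (i - j)) * c (i - j) else 0)"

text \<open>The transpose of the rotation derivative, acting on linear functionals \<open>\<psi>\<close> on coefficient
sequences. At \<open>l = 0\<close> the meaningless index \<open>l - 1\<close> is harmless because
of the factor \<open>l\<close>, and at \<open>l = n\<close> likewise for \<open>l + 1\<close>.\<close>

definition rot_adj :: "nat \<Rightarrow> (nat \<Rightarrow> real) \<Rightarrow> nat \<Rightarrow> real" where
  "rot_adj n \<psi> l = real l * \<psi> (l - 1) - real (n - l) * \<psi> (l + 1)"

definition push_adj :: "(nat \<Rightarrow> real) \<Rightarrow> nat \<Rightarrow> (nat \<Rightarrow> real) \<Rightarrow> nat \<Rightarrow> real" where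
  "push_adj a n \<psi> l = real (n - l) * (\<Sum>j\<le>5. a j * \<psi> (l + j))"

lemma sum_atMost_lessThan: "f n = 0 \<Longrightarrow> sum f {..n} = sum f {..<n}" for f :: "nat \<Rightarrow> real"
  by (simp add: lessThan_Suc_atMost [symmetric])

lemma pairing_rot:
  "(\<Sum>i\<le>n. \<psi> i * rot n c i) = (\<Sum>l\<le>n. rot_adj n \<psi> l * c l)"
proof -
  have "(\<Sum>i\<le>n. \<psi> i * (if i < n then real (i + 1) * c (i + 1) else 0))
      = (\<Sum>i<n. \<psi> i * (real (i + 1) * c (i + 1)))"
    by (subst sum_atMost_lessThan) auto
  also have "\<dots> = (\<Sum>l\<le>n. real l * \<psi> (l - 1) * c l)"
    by (simp add: sum.atMost_shift algebra_simps)
  finally have 1: "(\<Sum>i\<le>n. \<psi> i * (if i < n then real (i + 1) * c (i + 1) else 0))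
      = (\<Sum>l\<le>n. real l * \<psi> (l - 1) * c l)" .
  have "(\<Sum>i\<le>n. \<psi> i * (if i = 0 then 0 else real (n + 1 - i) * c (i - 1)))
      = (\<Sum>l<n. real (n - l) * \<psi> (l + 1) * c l)"
    by (simp add: sum.atMost_shift algebra_simps)
  also have "\<dots> = (\<Sum>l\<le>n. real (n - l) * \<psi> (l + 1) * c l)"
    by (subst sum_atMost_lessThan) auto
  finally have 2: "(\<Sum>i\<le>n. \<psi> i * (if i = 0 then 0 else real (n + 1 - i) * c (i - 1)))
      = (\<Sum>l\<le>n. real (n - l) * \<psi> (l + 1) * c l)" .
  show ?thesis
    using 1 2 by (simp add: rot_def rot_adj_def right_diff_distrib left_diff_distrib sum_subtractf)
qed

text \<open>Only the pairs \<open>(i, j)\<close> with \<open>i - j < n\<close> contribute; on both sides the sum is reduced to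
these, with \<open>l = i - j\<close>.\<close>

lemma pairing_push:
  "(\<Sum>i\<le>n + 4. \<psi> i * push a n c i) = (\<Sum>l\<le>n. push_adj a n \<psi> l * c l)"
proof -
  have "(\<Sum>i\<le>n + 4. \<psi> i * push a n c i)
      = (\<Sum>i\<le>n + 4. \<Sum>j\<le>5. if j \<le> i then \<psi> i * (a j * real (n - (i - j)) * c (i - j)) else 0)"
    unfolding push_def sum_distrib_left by (intro sum.cong) auto
  also have "\<dots> = (\<Sum>j\<le>5. \<Sum>i\<le>n + 4. if j \<le> i then \<psi> i * (a j * real (n - (i - j)) * c (i
      - j)) else 0)"
    by (rule sum.swap)
  also have "\<dots> = (\<Sum>j\<le>5. \<Sum>l<n. \<psi> (l + j) * (a j * real (n - l) * c l))"
  proof (rule sum.cong[OF refl])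
    fix j :: nat assume "j \<in> {..5}"
    then have sub: "(\<lambda>l. l + j) ` {..<n} \<subseteq> {..n + 4}" by auto
    have "(\<Sum>l<n. \<psi> (l + j) * (a j * real (n - l) * c l))
        = (\<Sum>i\<in>(\<lambda>l. l + j) ` {..<n}. \<psi> i * (a j * real (n - (i - j)) * c (i - j)))"
      by (subst sum.reindex) (auto simp: inj_on_def)
    also have "\<dots> = (\<Sum>i\<in>(\<lambda>l. l + j) ` {..<n}. if j
        \<le> i then \<psi> i * (a j * real (n - (i - j)) * c (i - j)) else 0)"
      by (rule sum.cong) auto
    also have "\<dots> = (\<Sum>i\<le>n + 4. if j \<le> i then \<psi> i * (a j * real (n - (i - j)) * c (i - j)) else 0)"
    proof (rule sum.mono_neutral_left[OF _ sub], simp, intro ballI)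
      fix i assume i: "i \<in> {..n + 4} - (\<lambda>l. l + j) ` {..<n}"
      have "n \<le> i - j" if "j \<le> i"
      proof (rule ccontr)
        assume "\<not> n \<le> i - j"
        then have "i = (i - j) + j" "i - j \<in> {..<n}" using that by auto
        then show False using i by blast
      qed
      then show "(if j \<le> i then \<psi> i * (a j * real (n - (i - j)) * c (i - j)) else 0) = 0"
        by simp
    qed
    finally show "(\<Sum>i\<le>n + 4. if j \<le> i then \<psi> i * (a j * real (n - (i - j)) * c (i - j)) else 0)
        = (\<Sum>l<n. \<psi> (l + j) * (a j * real (n - l) * c l))" ..
  qed
  also have "\<dots> = (\<Sum>l<n. \<Sum>j\<le>5. \<psi> (l + j) * (a j * real (n - l) * c l))"
    by (rule sum.swap)
  also have "\<dots> = (\<Sum>l<n. push_adj a n \<psi> l * c l)"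
    unfolding push_adj_def by (simp add: sum_distrib_left sum_distrib_right algebra_simps)
  also have "\<dots> = (\<Sum>l\<le>n. push_adj a n \<psi> l * c l)"
    by (rule sum_atMost_lessThan[symmetric]) (simp add: push_adj_def)
  finally show ?thesis .
qed

text \<open>\<open>H j\<close> is the homogeneous part of degree \<open>4 * j + 2\<close> of a formal first integral that starts
with \<open>(x^2 + y^2) / 2\<close>. The kernel of the rotation derivative consists of the multiples of the
power of \<open>x^2 + y^2\<close>, so each part is fixed by prescribing its coefficient at the pure power of
\<open>y\<close> to be zero.\<close>

definition formal_integral :: "(nat \<Rightarrow> real) \<Rightarrow> (nat \<Rightarrow> nat \<Rightarrow> real) \<Rightarrow> bool" where
  "formal_integral a H \<longleftrightarrow>
     H 0 = (\<lambda>i. if i = 0 \<or> i = 2 then 1 / 2 else 0) \<and>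
     (\<forall>j. H (Suc j) 0 = 0 \<and>
        (\<forall>i \<le> 4 * j + 6. rot (4 * j + 6) (H (Suc j)) i + push a (4 * j + 2) (H j) i = 0))"

lemma formal_integral_step:
  "formal_integral a H \<Longrightarrow> i \<le> 4 * j + 6 \<Longrightarrow>
    rot (4 * j + 6) (H (Suc j)) i + push a (4 * j + 2) (H j) i = 0"
  by (simp add: formal_integral_def)

text \<open>The level equation of a first integral, tested against \<open>\<psi>\<close> with both operators moved onto
the functional. This is the step that trades the form \<open>H (Suc j)\<close> for the form \<open>H j\<close> below it.\<close>

lemma formal_integral_pairing:
  assumes "formal_integral a H"
  shows "(\<Sum>l\<le>4 * j + 2. push_adj a (4 * j + 2) \<psi> l * H j l)
       = - (\<Sum>l\<le>4 * j + 6. rot_adj (4 * j + 6) \<psi> l * H (Suc j) l)"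
proof -
  have "(\<Sum>l\<le>4 * j + 2. push_adj a (4 * j + 2) \<psi> l * H j l)
      = (\<Sum>i\<le>4 * j + 2 + 4. \<psi> i * push a (4 * j + 2) (H j) i)"
    by (rule pairing_push[symmetric])
  also have "\<dots> = (\<Sum>i\<le>4 * j + 6. - (\<psi> i * rot (4 * j + 6) (H (Suc j)) i))"
    using formal_integral_step[OF assms, of _ j]
    by (intro sum.cong) (auto simp: add_eq_0_iff)
  finally show ?thesis
    by (simp only: pairing_rot sum_negf)
qed

section \<open>Poincare--Lyapunov theory: a center has a formal first integral\<close>

definition form :: "nat \<Rightarrow> (nat \<Rightarrow> real) \<Rightarrow> real \<Rightarrow> real \<Rightarrow> real" where
  "form n c x y = (\<Sum>i\<le>n. c i * (x ^ i * y ^ (n - i)))"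

text \<open>The monomials \<open>x ^ i * y ^ (n - i)\<close> are themselves a linear functional on coefficient
sequences, so the transposition formula already contains the reindexing that this identity and the
next one need.\<close>

lemma form_rot:
  "form n (rot n c) x y = (\<Sum>l\<le>n. c l * (real l * x ^ (l - 1) * y ^ (n - l) * y
      - x ^ l * (real (n - l) * y ^ (n - l - 1)) * x))"
proof -
  have "form n (rot n c) x y = (\<Sum>l\<le>n. rot_adj n (\<lambda>i. x ^ i * y ^ (n - i)) l * c l)"
    unfolding form_def pairing_rot[symmetric] by (simp add: mult.commute)
  also have "\<dots> = (\<Sum>l\<le>n. c l * (real l * x ^ (l - 1) * y ^ (n - l) * y
      - x ^ l * (real (n - l) * y ^ (n - l - 1)) * x))"
  proof (rule sum.cong[OF refl])
    fix l assume l: "l \<in> {..n}"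
    have eq: "real l * (x ^ (l - 1) * y ^ (n - (l - 1))) = real l * x ^ (l - 1) * y ^ (n - l) * y"
    proof (cases l)
      case (Suc m)
      then have "n - (l - 1) = Suc (n - l)" using l by auto
      then show ?thesis by simp
    qed simp
    show "rot_adj n (\<lambda>i. x ^ i * y ^ (n - i)) l * c l
        = c l * (real l * x ^ (l - 1) * y ^ (n - l) * y
      - x ^ l * (real (n - l) * y ^ (n - l - 1)) * x)"
      unfolding rot_adj_def eq by (simp add: algebra_simps)
  qed
  finally show ?thesis .
qed

lemma form_push:
  "form (n + 4) (push a n c) x y = (\<Sum>l\<le>n. c l * (x ^ l * (real (n - l) * y ^ (n - l - 1))
      * (\<Sum>j\<le>5. a j * x ^ j * y ^ (5 - j))))"
proof -
  have "form (n + 4) (push a n c) x y = (\<Sum>l\<le>n. push_adj a n (\<lambda>i. x ^ i * y ^ (n + 4 - i)) l * c l)"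
    unfolding form_def pairing_push[symmetric] by (simp add: mult.commute)
  also have "\<dots> = (\<Sum>l\<le>n. c l * (x ^ l * (real (n - l) * y ^ (n - l - 1))
      * (\<Sum>j\<le>5. a j * x ^ j * y ^ (5 - j))))"
  proof (rule sum.cong[OF refl])
    fix l assume "l \<in> {..n}"
    have "real (n - l) * (\<Sum>j\<le>5. a j * (x ^ (l + j) * y ^ (n + 4 - (l + j))))
        = real (n - l) * (\<Sum>j\<le>5. x ^ l * y ^ (n - l - 1) * (a j * x ^ j * y ^ (5 - j)))"
    proof (cases "l < n")
      case True
      have "a j * (x ^ (l + j) * y ^ (n + 4 - (l + j)))
          = x ^ l * y ^ (n - l - 1) * (a j * x ^ j * y ^ (5 - j))"
        if "j \<in> {..5}" for j
      proof -
        have "n + 4 - (l + j) = (n - l - 1) + (5 - j)" using True that by auto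
        then show ?thesis by (simp add: power_add)
      qed
      then show ?thesis by (metis (no_types, lifting) sum.cong)
    qed simp
    then show "push_adj a n (\<lambda>i. x ^ i * y ^ (n + 4 - i)) l * c l
        = c l * (x ^ l * (real (n - l) * y ^ (n - l - 1))
      * (\<Sum>j\<le>5. a j * x ^ j * y ^ (5 - j)))"
      unfolding push_adj_def sum_distrib_left[symmetric]
      by (simp only: mult.assoc mult.commute mult.left_commute)
  qed
  finally show ?thesis .
qed

lemma form_derivative:
  assumes x: "(x has_real_derivative y t) (at t)"
    and y: "(y has_real_derivative - x t + (\<Sum>j\<le>5. a j * x t ^ j * y t ^ (5 - j))) (at t)"
  shows "((\<lambda>t. form n c (x t) (y t)) has_real_derivative
      form n (rot n c) (x t) (y t) + form (n + 4) (push a n c) (x t) (y t)) (at t)"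
proof -
  define N where "N = (\<Sum>j\<le>5. a j * x t ^ j * y t ^ (5 - j))"
  have "((\<lambda>t. form n c (x t) (y t)) has_real_derivative
     (\<Sum>l\<le>n. c l * (real l * x t ^ (l - 1) * y t ^ (n - l) * y t
        + x t ^ l * (real (n - l) * y t ^ (n - l - 1)) * (- x t + N)))) (at t)"
    unfolding form_def
    by (rule DERIV_sum, rule DERIV_cmult) (auto intro!: derivative_eq_intros x y simp: N_def algebra_simps)
  also have "(\<Sum>l\<le>n. c l * (real l * x t ^ (l - 1) * y t ^ (n - l) * y t
        + x t ^ l * (real (n - l) * y t ^ (n - l - 1)) * (- x t + N)))
     = form n (rot n c) (x t) (y t) + form (n + 4) (push a n c) (x t) (y t)"
    unfolding form_rot form_push N_def[symmetric] sum.distrib[symmetric]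
    by (rule sum.cong) (simp_all add: algebra_simps)
  finally show ?thesis .
qed

lemma abs_form_le:
  "\<bar>form n c x y\<bar> \<le> (\<Sum>i\<le>n. \<bar>c i\<bar>) * norm (x, y) ^ n"
proof -
  have "\<bar>form n c x y\<bar> \<le> (\<Sum>i\<le>n. \<bar>c i * (x ^ i * y ^ (n - i))\<bar>)"
    unfolding form_def by (rule sum_abs)
  also have "\<dots> \<le> (\<Sum>i\<le>n. \<bar>c i\<bar> * norm (x, y) ^ n)"
  proof (rule sum_mono)
    fix i assume i: "i \<in> {..n}"
    have "\<bar>x\<bar> ^ i * \<bar>y\<bar> ^ (n - i) \<le> norm (x, y) ^ i * norm (x, y) ^ (n - i)"
      using abs_fst_le_norm[of "(x, y)"] abs_snd_le_norm[of "(x, y)"]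
      by (intro mult_mono power_mono) auto
    also have "\<dots> = norm (x, y) ^ n" using i by (simp add: power_add[symmetric])
    finally show "\<bar>c i * (x ^ i * y ^ (n - i))\<bar> \<le> \<bar>c i\<bar> * norm (x, y) ^ n"
      by (simp add: abs_mult power_abs mult_left_mono)
  qed
  finally show ?thesis by (simp add: sum_distrib_right)
qed

text \<open>Reverse time if \<open>\<sigma> = -1\<close>, so that \<open>V\<close> decreases along orbits. Comparable to the squared
norm, it then keeps an orbit starting well inside the ball in the ball for ever, and strict
decrease contradicts periodicity. The argument is needed because the orbits in the definition of a
center may leave the neighborhood.\<close>

lemma definite_derivative_not_center:
  fixes F :: "real \<times> real \<Rightarrow> real \<times> real" and V W :: "real \<times> real \<Rightarrow> real"
  assumes V': "\<And>u t. global_solution F u \<Longrightarrow> ((\<lambda>t. V (u t)) has_real_derivative W (u t)) (at t)"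
    and V_bounds: "\<And>z. norm z \<le> \<rho> \<Longrightarrow> (norm z)\<^sup>2 / 4 \<le> V z \<and> V z \<le> (norm z)\<^sup>2"
    and W: "\<And>z. norm z \<le> \<rho> \<Longrightarrow> \<sigma> * W z \<le> 0 \<and> (\<sigma> * W z = 0 \<longrightarrow> z = 0)"
    and "0 < \<rho>" and \<sigma>: "\<bar>\<sigma>\<bar> = 1"
  shows "\<not> center F (0, 0)"
proof
  assume "center F (0, 0)"
  then obtain U where U: "0 \<in> interior U"
    and orbits: "\<And>q. q \<in> U - {0} \<Longrightarrow> \<exists>\<Gamma>. periodic_orbit F \<Gamma> \<and> q \<in> \<Gamma>"
    unfolding center_def zero_prod_def by blast
  from U obtain \<delta> where "\<delta> > 0" "ball 0 \<delta> \<subseteq> U"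
    by (auto simp: mem_interior)
  \<comment> \<open>Below \<open>\<rho> / 2\<close>, so that \<open>V q \<le> s^2\<close> is less than the lower bound \<open>\<rho>^2 / 4\<close> of \<open>V\<close> on the sphere.\<close>
  define s where "s = min \<delta> \<rho> / 4"
  have s: "0 < s" "s < \<delta>" "s < \<rho> / 2"
    using \<open>\<delta> > 0\<close> \<open>\<rho> > 0\<close> by (auto simp: s_def min_def)
  define q :: "real \<times> real" where "q = (s, 0)"
  have norm_q: "norm q = s" using s by (simp add: q_def)
  then have "q \<in> U - {0}"
    using \<open>ball 0 \<delta> \<subseteq> U\<close> s by auto
  then obtain \<Gamma> where "periodic_orbit F \<Gamma>" "q \<in> \<Gamma>"
    using orbits by blast
  then obtain u T t0 where u: "global_solution F u" and "T > 0"
    and period: "\<And>t. u (t + T) = u t" and t0: "u t0 = q"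
    unfolding periodic_orbit_def by blast
  define v where "v t = u (t0 + \<sigma> * t)" for t
  have v0: "v 0 = q" by (simp add: v_def t0)
  have "\<sigma> = 1 \<or> \<sigma> = - 1" using \<sigma> by linarith
  then have vT: "v T = q"
    using period[of t0] period[of "t0 - T"] t0 by (auto simp: v_def)
  have \<phi>': "((\<lambda>t. V (v t)) has_real_derivative \<sigma> * W (v t)) (at t)" for t
  proof -
    have "((\<lambda>t. V (u (t0 + \<sigma> * t))) has_real_derivative W (u (t0 + \<sigma> * t)) * \<sigma>) (at t)"
      by (rule DERIV_chain2[OF V'[OF u]]) (auto intro!: derivative_eq_intros)
    then show ?thesis by (simp add: v_def mult.commute)
  qed
  have "isCont u t" for t
    using u by (auto simp: global_solution_def intro: has_vector_derivative_continuous)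
  then have "isCont v t" for t
    unfolding v_def by (intro isCont_o2[of t "\<lambda>t. t0 + \<sigma> * t" u]) auto
  then have norm_cont: "continuous_on S (\<lambda>t. norm (v t))" for S
    by (intro continuous_at_imp_continuous_on ballI continuous_norm)
  have decreasing: "V (v t) \<le> V (v r)" if "r \<le> t" "\<And>x. r \<le> x \<Longrightarrow> x \<le> t \<Longrightarrow> norm (v x) \<le> \<rho>" for r t
  proof (rule DERIV_nonpos_imp_nonincreasing[OF that(1)])
    fix x assume "r \<le> x" "x \<le> t"
    then have "\<sigma> * W (v x) \<le> 0" using W that(2) by simp
    then show "\<exists>y. ((\<lambda>t. V (v t)) has_real_derivative y) (at x) \<and> y \<le> 0"
      using \<phi>'[of x] by blast
  qed
  have inside: "norm (v t) < \<rho>" if "0 \<le> t" for t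
  proof (rule ccontr)
    assume "\<not> norm (v t) < \<rho>"
    define S where "S = {x \<in> {0..t}. norm (v x) = \<rho>}"
    have "\<exists>x\<ge>0. x \<le> t \<and> norm (v x) = \<rho>"
      by (rule IVT') (use \<open>\<not> norm (v t) < \<rho>\<close> v0 norm_q s that norm_cont in auto)
    then have "S \<noteq> {}" by (auto simp: S_def)
    have "S = {0..t} \<inter> (\<lambda>x. norm (v x)) -` {\<rho>}" by (auto simp: S_def)
    then have "closed S"
      using continuous_closed_preimage[OF norm_cont, of "{0..t}" "{\<rho>}"] by simp
    moreover have "bounded S"
      by (rule bounded_subset[of "{0..t}"]) (simp_all add: S_def subset_eq)
    ultimately have "compact S" by (simp add: compact_eq_bounded_closed)
    \<comment> \<open>The first time at which the orbit reaches the sphere.\<close>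
    then obtain x where x: "x \<in> S" and least: "\<And>y. y \<in> S \<Longrightarrow> x \<le> y"
      using compact_attains_inf[OF _ \<open>S \<noteq> {}\<close>] by blast
    have "norm (v y) \<le> \<rho>" if "0 \<le> y" "y \<le> x" for y
    proof (rule ccontr)
      assume "\<not> norm (v y) \<le> \<rho>"
      then have "\<exists>z\<ge>0. z \<le> y \<and> norm (v z) = \<rho>"
        by (intro IVT') (use v0 norm_q s that norm_cont in auto)
      then obtain z where "0 \<le> z" "z \<le> y" "norm (v z) = \<rho>" by blast
      then have "z \<in> S" using that x by (auto simp: S_def)
      then have "z = y" using least[of z] that \<open>z \<le> y\<close> by linarith
      then show False using \<open>norm (v z) = \<rho>\<close> \<open>\<not> norm (v y) \<le> \<rho>\<close> by simp
    qed
    then have "V (v x) \<le> V (v 0)"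
      using x by (intro decreasing) (auto simp: S_def)
    also have "\<dots> \<le> s\<^sup>2" using V_bounds[of q] norm_q s \<open>\<rho> > 0\<close> by (simp add: v0)
    also have "\<dots> < (\<rho> / 2)\<^sup>2" using s by (intro power_strict_mono) auto
    also have "\<dots> \<le> V (v x)" using V_bounds[of "v x"] x by (simp add: S_def power_divide)
    finally show False by simp
  qed
  obtain \<xi> where \<xi>: "0 < \<xi>" "\<xi> < T" "V (v T) - V (v 0) = (T - 0) * (\<sigma> * W (v \<xi>))"
    using MVT2[OF \<open>T > 0\<close>, of "\<lambda>t. V (v t)" "\<lambda>t. \<sigma> * W (v t)"] \<phi>' by blast
  then have "\<sigma> * W (v \<xi>) = 0" using \<open>T > 0\<close> by (simp add: v0 vT)
  moreover have "norm (v \<xi>) \<le> \<rho>" using inside[of \<xi>] \<xi>(1) by simp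
  ultimately have "v \<xi> = 0" using W by blast
  then have "V (v \<xi>) = 0" using V_bounds[of 0] \<open>\<rho> > 0\<close> by simp
  moreover have "V (v T) \<le> V (v \<xi>)"
    using \<xi> inside by (intro decreasing) (auto intro!: less_imp_le)
  moreover have "V (v T) > 0"
    using V_bounds[of q] norm_q s by (simp add: vT) (smt (verit) divide_pos_pos zero_less_power)
  ultimately show False by simp
qed

abbreviation quintic_rotation :: "(nat \<Rightarrow> real) \<Rightarrow> real \<times> real \<Rightarrow> real \<times> real" where
  "quintic_rotation a \<equiv> (\<lambda>(x, y). (y, - x + (\<Sum>j\<le>5. a j * x ^ j * y ^ (5 - j))))"

lemma form_add: "form n c x y + form n d x y = form n (\<lambda>i. c i + d i) x y"
  by (simp add: form_def sum.distrib[symmetric] algebra_simps)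

lemma form_cong: "(\<And>i. i \<le> n \<Longrightarrow> c i = d i) \<Longrightarrow> form n c x y = form n d x y"
  by (simp add: form_def)

text \<open>The definite form \<open>x ^ n + y ^ n\<close> (\<open>n\<close> even) measures the obstruction at each level. It has
only two coefficients, which makes solving up to its multiples easier than with a power of \<open>x^2 +
y^2\<close>.\<close>

lemma form_ends:
  assumes "0 < n"
  shows "form n (\<lambda>i. L * (if i = 0 \<or> i = n then 1 else 0)) x y = L * (x ^ n + y ^ n)"
proof -
  have "form n (\<lambda>i. L * (if i = 0 \<or> i = n then 1 else 0)) x y
      = (\<Sum>i\<le>n. (if i = 0 then L * y ^ n else 0) + (if i = n then L * x ^ n else 0))"
    unfolding form_def using assms by (intro sum.cong) auto
  also have "\<dots> = L * (x ^ n + y ^ n)"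
    by (simp add: sum.distrib algebra_simps)
  finally show ?thesis .
qed

lemma even_powers_ge:
  fixes x y :: real
  shows "norm (x, y) ^ (2 * m) / 2 ^ m \<le> x ^ (2 * m) + y ^ (2 * m)"
proof -
  have r: "norm (x, y) ^ 2 = x\<^sup>2 + y\<^sup>2" by (simp add: norm_prod_def)
  have "norm (x, y) ^ (2 * m) / 2 ^ m = ((x\<^sup>2 + y\<^sup>2) / 2) ^ m"
    by (simp add: power_mult r power_divide)
  also have "\<dots> \<le> (max (x\<^sup>2) (y\<^sup>2)) ^ m"
    by (intro power_mono) auto
  also have "\<dots> \<le> (x\<^sup>2) ^ m + (y\<^sup>2) ^ m"
    by (simp add: max_def)
  finally show ?thesis by (simp add: power_mult)
qed

text \<open>The derivative of the truncated series telescopes to \<open>L * (x ^ N + y ^ N)\<close> plus a form of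
degree \<open>N + 4\<close>, which is negligible near the origin; so the derivative has the sign of \<open>L\<close>.\<close>

lemma lyapunov_quantity_not_center:
  fixes a :: "nat \<Rightarrow> real"
  assumes H0: "H 0 = (\<lambda>i. if i = 0 \<or> i = 2 then 1 / 2 else 0)"
    and eqs: "\<And>j i. j < k \<Longrightarrow> i \<le> 4 * j + 6 \<Longrightarrow>
      rot (4 * j + 6) (H (Suc j)) i + push a (4 * j + 2) (H j) i = 0"
    and last: "\<And>i. i \<le> 4 * k + 6 \<Longrightarrow> rot (4 * k + 6) (H (Suc k)) i + push a (4 * k + 2) (H k) i
      = L * (if i = 0 \<or> i = 4 * k + 6 then 1 else 0)"
    and "L \<noteq> 0"
  shows "\<not> center (quintic_rotation a) (0, 0)"
proof -
  define N where "N = 4 * k + 6"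
  define V where "V z = (\<Sum>j\<le>Suc k. form (4 * j + 2) (H j) (fst z) (snd z))" for z
  define W where "W z = L * (fst z ^ N + snd z ^ N) + form (N
      + 4) (push a N (H (Suc k))) (fst z) (snd z)" for z
  have form2: "form 2 (H 0) x y = (x\<^sup>2 + y\<^sup>2) / 2" for x y
    by (simp add: form_def H0 eval_nat_numeral field_simps)
  have V': "((\<lambda>t. V (u t)) has_real_derivative W (u t)) (at t)"
    if u: "global_solution (quintic_rotation a) u" for u t
  proof -
    define R where "R j = form (4 * j + 2) (rot (4 * j + 2) (H j)) (fst (u t)) (snd (u t))" for j
    define P where "P j = form (4 * j + 6) (push a (4 * j + 2) (H j)) (fst (u t)) (snd (u t))" for j
    have "((\<lambda>t. V (u t)) has_real_derivative (\<Sum>j\<le>Suc k. R j + P j)) (at t)"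
      unfolding V_def
    proof (rule DERIV_sum)
      fix j
      have "((\<lambda>t. form (4 * j + 2) (H j) (fst (u t)) (snd (u t))) has_real_derivative
          R j + form (4 * j + 2 + 4) (push a (4 * j + 2) (H j)) (fst (u t)) (snd (u t))) (at t)"
        unfolding R_def
        by (rule form_derivative) (use u in \<open>simp_all add: planar_solution_iff\<close>)
      moreover have "4 * j + 2 + 4 = 4 * j + 6" by simp
      ultimately show "((\<lambda>t. form (4 * j + 2) (H j) (fst (u t)) (snd (u t))) has_real_derivative R j + P j) (at t)"
        unfolding P_def by metis
    qed
    moreover have "(\<Sum>j\<le>Suc k. R j + P j) = W (u t)"
    proof -
      have RP: "R (Suc j) + P j = form (4 * j + 6)
          (\<lambda>i. rot (4 * j + 6) (H (Suc j)) i + push a (4 * j + 2) (H j) i) (fst (u t)) (snd (u t))" for j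
        by (simp add: R_def P_def form_add add.commute[of 6])
      have "(\<Sum>j\<le>Suc k. R j + P j) = R 0 + (\<Sum>j<k. R (Suc j) + P j) + (R (Suc k) + P k) + P (Suc k)"
        unfolding sum.distrib sum.atMost_Suc_shift[of R]
        by (simp add: lessThan_Suc_atMost[symmetric])
      moreover have "R 0 = 0"
        by (simp add: R_def form_def rot_def H0 eval_nat_numeral)
      moreover have "(\<Sum>j<k. R (Suc j) + P j) = 0"
      proof (rule sum.neutral, rule ballI)
        fix j assume "j \<in> {..<k}"
        then show "R (Suc j) + P j = 0"
          using eqs[of j] by (simp add: RP form_def)
      qed
      moreover have "R (Suc k) + P k = L * (fst (u t) ^ N + snd (u t) ^ N)"
      proof -
        have "R (Suc k) + P k = form N (\<lambda>i. L * (if i = 0 \<or> i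
            = N then 1 else 0)) (fst (u t)) (snd (u t))"
          unfolding RP N_def by (rule form_cong) (rule last)
        then show ?thesis by (simp add: form_ends N_def)
      qed
      moreover have "P (Suc k) = form (N + 4) (push a N (H (Suc k))) (fst (u t)) (snd (u t))"
        by (simp add: P_def N_def add.commute)
      ultimately show ?thesis by (simp add: W_def)
    qed
    ultimately show ?thesis by simp
  qed
  define C where "C = (\<Sum>j\<le>k. \<Sum>i\<le>4 * Suc j + 2. \<bar>H (Suc j) i\<bar>)"
  define D where "D = (\<Sum>i\<le>N + 4. \<bar>push a N (H (Suc k)) i\<bar>)"
  define m where "m = 2 * k + 3"
  have N: "N = 2 * m" by (simp add: N_def m_def)
  have "C \<ge> 0" "D \<ge> 0" by (simp_all add: C_def D_def sum_nonneg)
  define e where "e = \<bar>L\<bar> / 2 ^ m"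
  have "e > 0" using \<open>L \<noteq> 0\<close> by (simp add: e_def)
  \<comment> \<open>In this ball the higher forms change \<open>V\<close> by at most a quarter of the squared norm, and the
    remainder of the derivative is smaller than its definite part.\<close>
  define \<rho> where "\<rho> = min 1 (min (1 / (4 * (C + 1))) (e / (D + 1)))"
  have "\<rho> > 0" "\<rho> \<le> 1" using \<open>C \<ge> 0\<close> \<open>D \<ge> 0\<close> \<open>e > 0\<close> by (simp_all add: \<rho>_def)
  have "\<rho> \<le> 1 / (4 * (C + 1))" "\<rho> \<le> e / (D + 1)" by (simp_all add: \<rho>_def)
  then have "(C + 1) * \<rho> \<le> 1 / 4" and "(D + 1) * \<rho> \<le> e"
    using \<open>C \<ge> 0\<close> \<open>D \<ge> 0\<close> by (simp_all add: field_simps)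
  then have C\<rho>: "C * \<rho> \<le> 1 / 4" and D\<rho>: "D * \<rho> < e"
    using \<open>\<rho> > 0\<close> by (simp_all add: distrib_right)
  have V_bounds: "(norm z)\<^sup>2 / 4 \<le> V z \<and> V z \<le> (norm z)\<^sup>2" if z: "norm z \<le> \<rho>" for z
  proof -
    define S where "S = (\<Sum>j\<le>k. form (4 * Suc j + 2) (H (Suc j)) (fst z) (snd z))"
    have "V z = form (4 * 0 + 2) (H 0) (fst z) (snd z) + S"
      by (simp only: V_def S_def sum.atMost_Suc_shift)
    also have "form (4 * 0 + 2) (H 0) (fst z) (snd z) = (norm z)\<^sup>2 / 2"
      by (simp only: mult_0_right add_0 form2 norm_prod_def) simp
    finally have V: "V z = (norm z)\<^sup>2 / 2 + S" .
    have "\<bar>S\<bar> \<le> (\<Sum>j\<le>k. \<bar>form (4 * Suc j + 2) (H (Suc j)) (fst z) (snd z)\<bar>)"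
      unfolding S_def by (rule sum_abs)
    also have "\<dots> \<le> (\<Sum>j\<le>k. (\<Sum>i\<le>4 * Suc j + 2. \<bar>H (Suc j) i\<bar>) * norm z ^ 3)"
    proof (rule sum_mono)
      fix j
      have "\<bar>form (4 * Suc j + 2) (H (Suc j)) (fst z) (snd z)\<bar>
          \<le> (\<Sum>i\<le>4 * Suc j + 2. \<bar>H (Suc j) i\<bar>) * norm z ^ (4 * Suc j + 2)"
        using abs_form_le[of "4 * Suc j + 2" "H (Suc j)" "fst z" "snd z"] by simp
      also have "norm z ^ (4 * Suc j + 2) \<le> norm z ^ 3"
        using z \<open>\<rho> \<le> 1\<close> by (intro power_decreasing) auto
      finally show "\<bar>form (4 * Suc j + 2) (H (Suc j)) (fst z) (snd z)\<bar>
          \<le> (\<Sum>i\<le>4 * Suc j + 2. \<bar>H (Suc j) i\<bar>) * norm z ^ 3"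
        by (simp add: mult_left_mono sum_nonneg del: sum.atMost_Suc)
    qed
    also have "\<dots> = C * norm z ^ 3"
      by (simp only: C_def sum_distrib_right)
    also have "\<dots> = C * norm z * (norm z)\<^sup>2"
      by (simp add: power3_eq_cube power2_eq_square)
    also have "\<dots> \<le> 1 / 4 * (norm z)\<^sup>2"
      using mult_left_mono[OF z \<open>C \<ge> 0\<close>] C\<rho> by (intro mult_right_mono) auto
    finally show ?thesis using V by linarith
  qed
  have W_sign: "- sgn L * W z \<le> 0 \<and> (- sgn L * W z = 0 \<longrightarrow> z = 0)" if z: "norm z \<le> \<rho>" for z
  proof -
    have "\<bar>form (N + 4) (push a N (H (Suc k))) (fst z) (snd z)\<bar> \<le> D * norm z ^ (N + 4)"
      using abs_form_le[of "N + 4" "push a N (H (Suc k))" "fst z" "snd z"]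
      by (simp add: D_def del: sum.atMost_Suc)
    also have "\<dots> \<le> D * norm z ^ (N + 1)"
      using z \<open>\<rho> \<le> 1\<close> \<open>D \<ge> 0\<close> by (intro mult_left_mono power_decreasing) auto
    also have "\<dots> \<le> D * \<rho> * norm z ^ N"
      using mult_left_mono[OF z \<open>D \<ge> 0\<close>] by (simp add: mult.assoc[symmetric] mult_right_mono)
    finally have rest: "- sgn L * form (N + 4) (push a N (H (Suc k))) (fst z) (snd z)
        \<le> D * \<rho> * norm z ^ N"
      using \<open>L \<noteq> 0\<close> by (auto simp: sgn_if abs_le_iff)
    have "e * norm z ^ N \<le> \<bar>L\<bar> * (fst z ^ N + snd z ^ N)"
      using mult_left_mono[OF even_powers_ge[of "fst z" "snd z" m], of "\<bar>L\<bar>"]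
      by (simp add: N e_def)
    then have "- sgn L * W z \<le> - (e - D * \<rho>) * norm z ^ N"
      using rest \<open>L \<noteq> 0\<close> by (simp add: W_def algebra_simps sgn_mult_abs[symmetric] abs_sgn)
    moreover have "(e - D * \<rho>) * norm z ^ N \<ge> 0" "(e - D * \<rho>) * norm z ^ N = 0 \<longrightarrow> z = 0"
      using D\<rho> by (simp_all add: N_def)
    ultimately show ?thesis by linarith
  qed
  show ?thesis
  proof (rule definite_derivative_not_center)
    show "\<bar>- sgn L\<bar> = 1" using \<open>L \<noteq> 0\<close> by (simp add: abs_sgn_eq)
  qed (fact V' V_bounds W_sign \<open>\<rho> > 0\<close>)+
qed

text \<open>The equations for the rotation derivative form a two-term recursion in steps of two. Started
with a zero coefficient, it determines all coefficients from all but the last equation.\<close>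

fun solve_rot :: "nat \<Rightarrow> (nat \<Rightarrow> real) \<Rightarrow> nat \<Rightarrow> real" where
  "solve_rot n f 0 = 0"
| "solve_rot n f (Suc 0) = f 0"
| "solve_rot n f (Suc (Suc i)) = (f (Suc i) + real (n - i) * solve_rot n f i) / real (i + 2)"

lemma rot_solve_rot: "i < n \<Longrightarrow> rot n (solve_rot n f) i = f i"
  by (cases i) (auto simp: rot_def field_simps)

lemma solve_rot_linear:
  "solve_rot n (\<lambda>i. L * f i - g i) i = L * solve_rot n f i - solve_rot n g i"
proof (induction n f i rule: solve_rot.induct)
  case (3 n f i)
  have "(L * f (Suc i) - g (Suc i) + m * (L * A - B)) / d
      = L * ((f (Suc i) + m * A) / d) - (g (Suc i) + m * B) / d" for m A B d :: real
    by (simp add: diff_divide_distrib[symmetric] algebra_simps)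
  then show ?case by (simp only: solve_rot.simps 3)
qed simp_all

lemma solve_rot_nonneg: "(\<And>i. 0 \<le> f i) \<Longrightarrow> 0 \<le> solve_rot n f i"
  by (induction n f i rule: solve_rot.induct) simp_all

text \<open>The one equation that the recursion cannot serve, at index \<open>n\<close>, is met by the choice of \<open>L\<close>:
the recursion is linear in its right hand side and monotone, so the coefficient \<open>1 + \<beta>\<close> of \<open>L\<close> in
this equation is positive.\<close>

lemma solve_homological_equation:
  assumes "0 < n"
  shows "\<exists>h. h 0 = 0 \<and> (\<exists>L. \<forall>i\<le>n. rot n h i + q i = L * (if i = 0 \<or> i = n then 1 else 0))"
proof -
  define \<rho> where "\<rho> i = (if i = 0 \<or> i = n then 1 else 0 :: real)" for i
  define \<beta> where "\<beta> = solve_rot n \<rho> (n - 1)"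
  define L where "L = (q n + solve_rot n q (n - 1)) / (1 + \<beta>)"
  define h where "h = solve_rot n (\<lambda>i. L * \<rho> i - q i)"
  have "\<beta> \<ge> 0" unfolding \<beta>_def by (rule solve_rot_nonneg) (simp add: \<rho>_def)
  then have L: "L * (1 + \<beta>) = q n + solve_rot n q (n - 1)" by (simp add: L_def)
  have "rot n h n = - h (n - 1)" using assms by (simp add: rot_def)
  also have "\<dots> = - (L * \<beta> - solve_rot n q (n - 1))"
    by (simp add: h_def solve_rot_linear \<beta>_def)
  finally have "rot n h n + q n = L * \<rho> n"
    using L assms by (simp add: \<rho>_def algebra_simps)
  moreover have "rot n h i + q i = L * \<rho> i" if "i < n" for i
    using rot_solve_rot[OF that] by (simp add: h_def)
  ultimately have "\<forall>i\<le>n. rot n h i + q i = L * \<rho> i"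
    using nat_less_le by blast
  then show ?thesis by (intro exI[of _ h]) (auto simp: h_def \<rho>_def)
qed

text \<open>The forms are built by solving one homological equation after the other. By induction all
obstructions vanish, as the first one that does not would exclude a center.\<close>

lemma center_imp_formal_integral:
  assumes center: "center (quintic_rotation a) (0, 0)"
  shows "\<exists>H. formal_integral a H"
proof -
  define next_form where "next_form j c = (SOME h. h 0 = 0 \<and> (\<exists>L. \<forall>i\<le>4 * j + 6.
      rot (4 * j + 6) h i + push a (4 * j + 2) c i = L * (if i = 0 \<or> i = 4 * j + 6 then 1 else 0)))"
    for j :: nat and c :: "nat \<Rightarrow> real"
  define H where "H = rec_nat (\<lambda>i. if i = 0 \<or> i = 2 then 1 / 2 else 0) next_form"
  have H0: "H 0 = (\<lambda>i. if i = 0 \<or> i = 2 then 1 / 2 else 0)"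
    and HSuc: "H (Suc j) = next_form j (H j)" for j
    by (simp_all add: H_def)
  have step: "H (Suc j) 0 = 0 \<and> (\<exists>L. \<forall>i\<le>4 * j + 6.
      rot (4 * j + 6) (H (Suc j)) i + push a (4 * j + 2) (H j) i = L * (if i = 0 \<or> i
          = 4 * j + 6 then 1 else 0))" for j
  proof -
    have "0 < 4 * j + 6" by simp
    from someI_ex[OF solve_homological_equation[OF this, of "push a (4 * j + 2) (H j)"]]
    show ?thesis unfolding HSuc next_form_def .
  qed
  have "\<forall>i\<le>4 * j + 6. rot (4 * j + 6) (H (Suc j)) i + push a (4 * j + 2) (H j) i = 0" for j
  proof (induction j rule: less_induct)
    case (less j)
    from step[of j] obtain L where L: "\<And>i. i \<le> 4 * j + 6 \<Longrightarrow>
      rot (4 * j + 6) (H (Suc j)) i + push a (4 * j + 2) (H j) i = L * (if i = 0 \<or> i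
          = 4 * j + 6 then 1 else 0)"
      by blast
    have "L = 0"
    proof (rule ccontr)
      assume "L \<noteq> 0"
      have "\<not> center (quintic_rotation a) (0, 0)"
        by (rule lyapunov_quantity_not_center[OF H0 _ L \<open>L \<noteq> 0\<close>]) (use less in blast)
      then show False using center by contradiction
    qed
    then show ?case using L by simp
  qed
  then have "formal_integral a H"
    unfolding formal_integral_def using H0 step by blast
  then show ?thesis by blast
qed

section \<open>The Lyapunov quantities of orders three, four and five\<close>

lemma atMost_5: "(\<Sum>j\<le>5. f j) = f 0 + f 1 + f 2 + f 3 + f 4 + f (5::nat)" for f :: "nat \<Rightarrow> real"
  by (simp add: eval_nat_numeral)

lemma atMost_10: "(\<Sum>j\<le>10. f j) = f 0 + f 1 + f 2 + f 3 + f 4 + f 5 + f 6 + f 7 + f 8 + f 9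
    + f (10::nat)" for f :: "nat \<Rightarrow> real"
  by (simp add: eval_nat_numeral)

text \<open>Up to a common factor, entry \<open>i\<close> is the mean of \<open>x ^ i * y ^ (14 - i)\<close> over the unit circle.
These functionals vanish on rotation derivatives and so detect the obstruction in degrees 14, 18
and 22. The scaling is chosen to avoid fractions in the functionals derived from them.\<close>

definition weights14 :: "real list" where
  "weights14 = [429, 0, 33, 0, 9, 0, 5, 0, 5, 0, 9, 0, 33, 0, 429]"

definition weights18 :: "real list" where
  "weights18 = [109395, 0, 6435, 0, 1287, 0, 495, 0, 315, 0, 315, 0, 495, 0, 1287, 0, 6435, 0,
      109395]"

definition weights22 :: "real list" where
  "weights22 = [87297210, 0, 4157010, 0, 656370, 0, 193050, 0, 90090, 0, 62370, 0, 62370, 0, 90090,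
      0, 193050, 0, 656370, 0, 4157010, 0, 87297210]"

text \<open>A functional \<open>\<psi>\<close> of degree 14 with \<open>\<psi> \<circ> rot = weights18 \<circ> push\<close>. It exists because the first
Lyapunov quantity vanishes, and it turns the obstruction in degree 18 into a condition on the form
of degree 10. From here on \<open>c\<close>, \<open>p\<close>, \<open>b\<close>, \<open>q\<close>, \<open>r\<close> stand for the coefficients \<open>a05\<close>, \<open>a14\<close>, \<open>a23\<close>,
\<open>a32\<close>, \<open>a50\<close>, and \<open>a41\<close> is \<open>- 5 * c - b\<close>.\<close>

definition pullback18 :: "real \<Rightarrow> real \<Rightarrow> real \<Rightarrow> real \<Rightarrow> real \<Rightarrow> real list" where
  "pullback18 c p b q r =
    [0, -102960*c - 5148*b, -6435*p - 1287*q - 495*r, -21120*c - 1650*b, -3042*p - 846*q - 450*r,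
    -8160*c - 840*b, -2185*p - 785*q - 565*r, -5040*c - 630*b, -2500*p - 1100*q - 1060*r,
    -4560*c - 660*b, -4815*p - 2475*q - 3195*r, -5280*c - 858*b, -18150*p - 10362*q - 18150*r, 0,
    -237237*p - 141141*q - 345345*r]"

text \<open>For degree 22 two pullbacks are needed, first to degree 18 and then to degree 14. The second
one exists only modulo the second Lyapunov quantity.\<close>

definition pullback22 :: "real \<Rightarrow> real \<Rightarrow> real \<Rightarrow> real \<Rightarrow> real \<Rightarrow> real list" where
  "pullback22 c p b q r =
    [0, -84015360*c - 3500640*b, -4157010*p - 656370*q - 193050*r, -13693680*c - 900900*b,
    -1487772*p - 324324*q - 128700*r, -4118400*c - 360360*b, -765270*p - 214830*q - 111870*r,
    -1940400*c - 207900*b, -577080*p - 199080*q - 133560*r, -1330560*c - 166320*b,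
    -639450*p - 261450*q - 223650*r, -1275120*c - 180180*b, -1067220*p - 500940*q - 544500*r,
    -1647360*c - 257400*b, -2864862*p - 1495494*q - 2072070*r, -2574000*c - 437580*b,
    -14517360*p - 8133840*q - 14517360*r, 0, -247451490*p - 142432290*q - 334092330*r]"

definition pullback22_twice :: "real \<Rightarrow> real \<Rightarrow> real \<Rightarrow> real \<Rightarrow> real \<Rightarrow> real list" where
  "pullback22_twice c p b q r =
    [0, 76576500*c*p + 12072060*c*q + 3474900*c*r + 6169878*p*b + 1232946*b*q + 424710*b*r,
    63423360*c^2 + 11274120*c*b + 4157010*p^2 + 2144142*p*q + 958320*p*r + 540540*b^2 + 324324*q^2
        + 343530*q*r + 111870*r^2,
    26787090*c*p + 5712630*c*q + 2153250*c*r + 2651715*p*b + 675345*b*q + 295515*b*r,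
    21288960*c^2 + 5114160*c*b + 2621502*p^2 + 1674360*p*q + 967140*p*r + 299880*b^2 + 303282*q^2
        + 404640*q*r + 164070*r^2,
    13435608*c*p + 3554376*c*q + 1652760*c*r + 1609236*p*b + 493788*b*q + 262836*b*r,
    9292800*c^2 + 2979800*c*b + 2221660*p^2 + 1722110*p*q + 1288620*p*r + 208180*b^2 + 367570*q^2
        + 619810*q*r + 314800*r^2,
    9585126*c*p + 2903922*c*q + 1508310*c*r + 1352457*p*b + 474291*b*q + 287217*b*r,
    4857600*c^2 + 2342240*c*b + 2798740*p^2 + 2560640*p*q + 2489400*p*r + 194320*b^2 + 629020*q^2
        + 1344400*q*r + 859300*r^2,
    9351708*c*p + 2841396*c*q + 1069500*c*r + 1541826*p*b + 573078*b*q + 319506*b*r,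
    1837440*c^2 + 2723112*c*b + 5677182*p^2 + 5937822*p*q + 7569432*p*r + 272556*b^2 + 1633176*q^2
        + 4459914*q*r + 3618810*r^2,
    10969530*c*p + 1534830*c*q - 4888950*c*r + 2237103*p*b + 695541*b*q - 291225*b*r,
    -4857600*c^2 + 7050384*c*b + 21883554*p^2 + 25137816*p*q + 42816444*p*r + 819192*b^2
        + 7483806*q^2 + 26558928*q*r + 27786330*r^2,
    -4055040*c*p - 28385280*c*q - 101376000*c*r + 2027520*p*b - 2027520*b*q - 14192640*b*r,
    -61501440*c^2 + 94486392*c*b + 287351064*p^2 + 342804462*p*q + 806137332*p*r + 11087076*b^2
        + 105423318*q^2 + 502215714*q*r + 695314620*r^2]"

text \<open>The form of degree 10 of the formal first integral. The entry at index 9 is zero because of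
the second Lyapunov quantity.\<close>

definition integral10 :: "real \<Rightarrow> real \<Rightarrow> real \<Rightarrow> real \<Rightarrow> real \<Rightarrow> real list" where
  "integral10 c p b q r =
    [0, 0, 5/2*c^2, 7/3*c*p, 25/4*c^2 + 3/2*c*b + 1/2*p^2, 67/15*c*p + 11/10*c*q + 3/5*p*b,
    25/12*c^2 + 3/2*c*b + 2/3*p^2 + 5/12*p*q + 1/6*b^2,
    37/21*c*p + 3/2*c*q + 5/7*c*r + 2/7*p*b + 3/14*b*q,
    -25/12*c^2 - 1/2*c*b + 1/3*p^2 + 1/3*p*q + 1/4*p*r - 1/24*b^2 + 1/16*q^2, 0,
    -5/12*c^2 - 1/10*c*b + 1/15*p^2 + 1/15*p*q + 3/20*p*r - 1/120*b^2 + 1/80*q^2 + 1/20*q*r]"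

text \<open>The Lyapunov quantities of orders three to five, each one up to a constant factor and modulo
the earlier ones.\<close>

definition lyapunov3 :: "real \<Rightarrow> real \<Rightarrow> real \<Rightarrow> real \<Rightarrow> real \<Rightarrow> real" where
  "lyapunov3 c p b q r =
    -4480*c^3 - 3248*c^2*b + 998*c*p^2 + 4938*c*p*q + 16288*c*p*r - 560*c*b^2 + 2016*c*q^2 +
    9126*c*q*r + 2970*c*r^2 - 310*p^2*b + 137*p*b*q + 1818*p*b*r - 28*b^3 + 117*b*q^2 + 891*b*q*r"

definition lyapunov4 :: "real \<Rightarrow> real \<Rightarrow> real \<Rightarrow> real \<Rightarrow> real \<Rightarrow> real" where
  "lyapunov4 c p b q r =
    2400080*c^3*p - 13269200*c^3*q - 48190000*c^3*r + 3970456*c^2*p*b - 2613112*c^2*b*q -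
    14292200*c^2*b*r - 1189096*c*p^3 - 7669508*c*p^2*q - 24479400*c*p^2*r + 831604*c*p*b^2 -
    7172070*c*p*q^2 - 34796176*c*p*q*r - 30395120*c*p*r^2 - 134644*c*b^2*q - 1524524*c*b^2*r -
    1933470*c*q^3 - 12522942*c*q^2*r - 21554100*c*q*r^2 - 6534000*c*r^3 + 448640*p^3*b +
    62808*p^2*b*q - 2249164*p^2*b*r + 54902*p*b^3 - 295997*p*b*q^2 - 3185572*p*b*q*r -
    2967660*p*b*r^2 + 3058*b^3*q - 66346*b^3*r - 119691*b*q^3 - 1150101*b*q^2*r - 1960200*b*q*r^2"

definition lyapunov5 :: "real \<Rightarrow> real \<Rightarrow> real \<Rightarrow> real \<Rightarrow> real \<Rightarrow> real" where
  "lyapunov5 c p b q r =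
    17835417600*c^5 + 12871752320*c^4*b + 696347344*c^3*p^2 + 37334291216*c^3*p*q +
    132719380800*c^3*p*r + 1948231040*c^3*b^2 + 18027743776*c^3*q^2 + 95433430000*c^3*q*r +
    124331436400*c^3*r^2 - 3332951984*c^2*p^2*b + 13014618568*c^2*p*b*q + 59040461200*c^2*p*b*r -
    34345920*c^2*b^3 + 6748524152*c^2*b*q^2 + 37719847640*c^2*b*q*r + 39679627520*c^2*b*r^2 +
    732921952*c*p^4 + 5331778832*c*p^3*q + 15889010840*c*p^3*r - 1249122412*c*p^2*b^2 +
    7957397950*c*p^2*q^2 + 35738324888*c*p^2*q*r + 27879216496*c*p^2*r^2 + 1260291108*c*p*b^2*q +
    8982397328*c*p*b^2*r + 4856970126*c*p*q^3 + 30413402888*c*p*q^2*r + 56868686504*c*p*q*r^2 +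
    36219561800*c*p*r^3 - 22838816*c*b^4 + 831514232*c*b^2*q^2 + 5310090140*c*b^2*q*r +
    4357385852*c*b^2*r^2 + 1075536756*c*q^4 + 8909462034*c*q^3*r + 27000647514*c*q^2*r^2 +
    35214231600*c*q*r^3 + 10003078800*c*r^4 - 283128608*p^4*b - 240214080*p^3*b*q +
    1263246840*p^3*b*r - 117551260*p^2*b^3 + 123194094*p^2*b*q^2 + 2710875484*p^2*b*q*r +
    1722897064*p^2*b*r^2 + 9547458*p*b^3*q + 455446116*p*b^3*r + 219164479*p*b*q^3 +
    2451325018*p*b*q^2*r + 4541823004*p*b*q*r^2 + 2602858320*p*b*r^3 - 1109528*b^5 +
    28621198*b^3*q^2 + 261028006*b^3*q*r + 195359920*b^3*r^2 + 68126139*b*q^4 + 777148821*b*q^3*r +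
    2453632344*b*q^2*r^2 + 3000923640*b*q*r^3"

lemma push_adj_weights18:
  assumes "l \<le> 14"
  shows "push_adj ((!) [c, p, b, q, - 5*c - b, r]) 14 ((!) weights18) l =
    rot_adj 14 ((!) (pullback18 c p b q r)) l"
proof -
  have "l \<in> {0,1,2,3,4,5,6,7,8,9,10,11,12,13,14}"
    using \<open>l \<le> 14\<close> by (simp, presburger)
  then show ?thesis
    by (elim insertE emptyE; simp add: weights18_def pullback18_def push_adj_def rot_adj_def atMost_5
        power2_eq_square algebra_simps)
qed

lemma push_adj_weights22:
  assumes "l \<le> 18"
  shows "push_adj ((!) [c, p, b, q, - 5*c - b, r]) 18 ((!) weights22) l =
    rot_adj 18 ((!) (pullback22 c p b q r)) l"
proof -
  have "l \<in> {0,1,2,3,4,5,6,7,8,9,10,11,12,13,14,15,16,17,18}"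
    using \<open>l \<le> 18\<close> by (simp, presburger)
  then show ?thesis
    by (elim insertE emptyE; simp add: weights22_def pullback22_def push_adj_def rot_adj_def atMost_5
        power2_eq_square algebra_simps)
qed

lemma push_adj_pullback22:
  assumes L2: "b * (p - q - 7*r) = 2*c * (p + 7*q + 25*r)"
    and "l \<le> 14"
  shows "push_adj ((!) [c, p, b, q, - 5*c - b, r]) 14 ((!) (pullback22 c p b q r)) l =
    rot_adj 14 ((!) (pullback22_twice c p b q r)) l"
proof -
  have "l \<in> {0,1,2,3,4,5,6,7,8,9,10,11,12,13,14}"
    using \<open>l \<le> 14\<close> by (simp, presburger)
  then show ?thesis using L2
    by (elim insertE emptyE; simp add: pullback22_def pullback22_twice_def push_adj_def rot_adj_def atMost_5
        power2_eq_square algebra_simps)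
qed

lemma rot_adj_weights14: "l \<le> 14 \<Longrightarrow> rot_adj 14 ((!) weights14) l = 0"
proof -
  assume "l \<le> 14"
  then have "l \<in> {0,1,2,3,4,5,6,7,8,9,10,11,12,13,14}"
    by (simp, presburger)
  then show ?thesis
    by (elim insertE emptyE; simp add: weights14_def rot_adj_def)
qed

lemma rot_adj_weights18: "l \<le> 18 \<Longrightarrow> rot_adj 18 ((!) weights18) l = 0"
proof -
  assume "l \<le> 18"
  then have "l \<in> {0,1,2,3,4,5,6,7,8,9,10,11,12,13,14,15,16,17,18}"
    by (simp, presburger)
  then show ?thesis
    by (elim insertE emptyE; simp add: weights18_def rot_adj_def)
qed

lemma rot_adj_weights22: "l \<le> 22 \<Longrightarrow> rot_adj 22 ((!) weights22) l = 0"
proof -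
  assume "l \<le> 22"
  then have "l \<in> {0,1,2,3,4,5,6,7,8,9,10,11,12,13,14,15,16,17,18,19,20,21,22}"
    by (simp, presburger)
  then show ?thesis
    by (elim insertE emptyE; simp add: weights22_def rot_adj_def)
qed

lemma pairing_lyapunov3:
  "(\<Sum>l\<le>10.
      push_adj ((!) [c, p, b, q, - 5*c - b, r]) 10 ((!) weights14) l * integral10 c p b q r ! l)
   = 1/42 * lyapunov3 c p b q r"
  by (simp add: push_adj_def atMost_5 atMost_10 integral10_def weights14_def lyapunov3_def, algebra)

lemma pairing_lyapunov4:
  "(\<Sum>l\<le>10.
      push_adj ((!) [c, p, b, q, - 5*c - b, r]) 10 ((!) (pullback18 c p b q r)) l * integral10 c p b q r ! l)
   = 1/168 * lyapunov4 c p b q r"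
  by (simp add: push_adj_def atMost_5 atMost_10 integral10_def pullback18_def lyapunov4_def, algebra)

lemma pairing_lyapunov5:
  "(\<Sum>l\<le>10.
      push_adj ((!) [c, p, b, q, - 5*c - b, r]) 10 ((!) (pullback22_twice c p b q r)) l * integral10 c p b q r ! l)
   = 1/168 * lyapunov5 c p b q r"
  by (simp add: push_adj_def atMost_5 atMost_10 integral10_def pullback22_twice_def lyapunov5_def, algebra)

text \<open>Levels zero and one are solved explicitly; their last equations are the first two Lyapunov
quantities. The three circle means of the levels two, three and four vanish, and moving down with
the pullbacks each of them becomes a pairing with the form of degree 10.\<close>

lemma formal_integral_conditions:
  assumes fi: "formal_integral ((!) [c, p, b, q, a4, r]) H"
  shows "a4 = - 5*c - b \<and> b * (p - q - 7*r) = 2*c * (p + 7*q + 25*r) \<and>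
     lyapunov3 c p b q r = 0 \<and> lyapunov4 c p b q r = 0 \<and> lyapunov5 c p b q r = 0"
proof -
  let ?a = "(!) [c, p, b, q, a4, r]"
  have H0: "H 0 = (\<lambda>i. if i = 0 \<or> i = 2 then 1 / 2 else 0)"
    and H10: "H 1 0 = 0" and H20: "H 2 0 = 0"
    using fi by (auto simp: formal_integral_def numeral_2_eq_2)
  have e0: "rot 6 (H 1) i + push ?a 2 (H 0) i = 0" if "i \<le> 6" for i
    using formal_integral_step[OF fi, of i 0] that by (simp add: H0 numeral_2_eq_2[symmetric])
  have e1: "rot 10 (H 2) i + push ?a 6 (H 1) i = 0" if "i \<le> 10" for i
    using formal_integral_step[OF fi, of i 1] that by (simp add: numeral_2_eq_2[symmetric])
  note eval = rot_def push_def atMost_5 H0 H10[simplified] H20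
  have odd6: "H 1 1 = - c" "3 * H 1 3 = - 5*c - b" "5 * H 1 5 = - 5*c - b - a4" "H 1 5 = 0"
    using e0[of 0] e0[of 2] e0[of 4] e0[of 6] by (simp_all add: eval)
  then have a4: "a4 = - 5*c - b" by simp
  have even6: "2 * H 1 2 = - p" "4 * H 1 4 = 4 * H 1 2 - q" "6 * H 1 6 = 2 * H 1 4 - r"
    using e0[of 1] e0[of 3] e0[of 5] by (simp_all add: eval numeral_2_eq_2[symmetric])
  have deg6: "H (Suc 0) (Suc 0) = - c" "H (Suc 0) 2 = - (p/2)" "H (Suc 0) 3 = - (5*c/3) - b/3"
    "H (Suc 0) 4 = - (p/2) - q/4" "H (Suc 0) 5 = 0" "H (Suc 0) 6 = - (p/6) - q/12 - r/6"
    using odd6 even6 by simp_all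
  have d1: "H 2 1 = 0"
    using e1[of 0] H20
    by (simp add: eval deg6 numeral_2_eq_2[symmetric] a4 power2_eq_square field_simps)
  have d2: "H 2 2 = 5/2*c^2"
    using e1[of 1] H20
    by (simp add: eval deg6 numeral_2_eq_2[symmetric] a4 power2_eq_square field_simps)
  have d3: "H 2 3 = 7/3*c*p"
    using e1[of 2] d1
    by (simp add: eval deg6 numeral_2_eq_2[symmetric] a4 power2_eq_square field_simps)
  have d4: "H 2 4 = 25/4*c^2 + 3/2*c*b + 1/2*p^2"
    using e1[of 3] d2
    by (simp add: eval deg6 numeral_2_eq_2[symmetric] a4 power2_eq_square field_simps)
  have d5: "H 2 5 = 67/15*c*p + 11/10*c*q + 3/5*p*b"
    using e1[of 4] d3
    by (simp add: eval deg6 numeral_2_eq_2[symmetric] a4 power2_eq_square field_simps)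
  have d6: "H 2 6 = 25/12*c^2 + 3/2*c*b + 2/3*p^2 + 5/12*p*q + 1/6*b^2"
    using e1[of 5] d4
    by (simp add: eval deg6 numeral_2_eq_2[symmetric] a4 power2_eq_square field_simps)
  have d7: "H 2 7 = 37/21*c*p + 3/2*c*q + 5/7*c*r + 2/7*p*b + 3/14*b*q"
    using e1[of 6] d5
    by (simp add: eval deg6 numeral_2_eq_2[symmetric] a4 power2_eq_square field_simps)
  have d8: "H 2 8 = -25/12*c^2 - 1/2*c*b + 1/3*p^2 + 1/3*p*q + 1/4*p*r - 1/24*b^2 + 1/16*q^2"
    using e1[of 7] d6
    by (simp add: eval deg6 numeral_2_eq_2[symmetric] a4 power2_eq_square field_simps)
  have d9: "H 2 9 = 0"
    using e1[of 10]
    by (simp add: eval deg6 numeral_2_eq_2[symmetric] a4 power2_eq_square field_simps)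
  have d10: "H 2 10 = -5/12*c^2 - 1/10*c*b + 1/15*p^2 + 1/15*p*q + 3/20*p*r - 1/120*b^2 + 1/80*q^2
      + 1/20*q*r"
    using e1[of 9] d8
    by (simp add: eval deg6 numeral_2_eq_2[symmetric] a4 power2_eq_square field_simps)
  have L2: "b * (p - q - 7*r) = 2*c * (p + 7*q + 25*r)"
    using e1[of 8] d7 d9
    by (simp add: eval deg6 numeral_2_eq_2[symmetric] a4 power2_eq_square field_simps)
  have deg10: "H 2 l = integral10 c p b q r ! l" if "l \<le> 10" for l
  proof -
    have "l \<in> {0,1,2,3,4,5,6,7,8,9,10}"
      using that by (simp, presburger)
    then show ?thesis
      by (elim insertE emptyE; simp add: integral10_def H20 d1[simplified] d2 d3 d4 d5 d6 d7 d8 d9 d10)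
  qed
  \<comment> \<open>\<open>Z \<psi> j\<close> is the value of \<open>\<psi>\<close> on the nonlinear term of level \<open>j\<close>, of degree \<open>4 * j + 6\<close>.\<close>
  define Z where "Z \<psi> j = (\<Sum>l\<le>4 * j + 2. push_adj ?a (4 * j + 2) \<psi> l * H j l)" for \<psi> j
  have Z_eq: "Z \<psi> j = - (\<Sum>l\<le>4 * j + 6. rot_adj (4 * j + 6) \<psi> l * H (Suc j) l)" for \<psi> j
    unfolding Z_def by (rule formal_integral_pairing[OF fi])
  have Z_step: "Z \<psi> j = - Z \<omega> (Suc j)"
    if "\<And>l. l \<le> 4 * j + 6 \<Longrightarrow> push_adj ?a (4 * j + 6) \<omega> l = rot_adj (4 * j + 6) \<psi> l" for \<psi> \<omega> j
  proof -
    have "4 * Suc j + 2 = 4 * j + 6" by simp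
    then have "Z \<omega> (Suc j) = (\<Sum>l\<le>4 * j + 6. push_adj ?a (4 * j + 6) \<omega> l * H (Suc j) l)"
      by (simp only: Z_def)
    also have "\<dots> = (\<Sum>l\<le>4 * j + 6. rot_adj (4 * j + 6) \<psi> l * H (Suc j) l)"
      by (intro sum.cong refl arg_cong2[where f = "(*)"] that) simp
    finally show ?thesis by (simp only: Z_eq[of \<psi>])
  qed
  have Z_0: "Z \<psi> j = 0"
    if "\<And>l. l \<le> 4 * j + 6 \<Longrightarrow> rot_adj (4 * j + 6) \<psi> l = 0" for \<psi> j
    unfolding Z_eq by (subst sum.neutral) (auto simp: that)
  have Z_2: "Z \<psi> 2 = (\<Sum>l\<le>10. push_adj ((!) [c, p, b, q, - 5*c
      - b, r]) 10 \<psi> l * integral10 c p b q r ! l)" for \<psi>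
    unfolding Z_def a4[symmetric] by (rule sum.cong) (simp_all add: deg10)
  have "Z ((!) weights14) 2 = 0"
    by (rule Z_0) (simp add: rot_adj_weights14)
  then have 3: "lyapunov3 c p b q r = 0"
    unfolding Z_2 pairing_lyapunov3 by simp
  have "Z ((!) weights18) 3 = 0"
    by (rule Z_0) (simp add: rot_adj_weights18)
  then have "Z ((!) (pullback18 c p b q r)) 2 = 0"
    using Z_step[of 2 "(!) weights18" "(!) (pullback18 c p b q r)"] push_adj_weights18[of _ c p b q r]
    by (simp add: a4 numeral_3_eq_3[symmetric])
  then have 4: "lyapunov4 c p b q r = 0"
    unfolding Z_2 pairing_lyapunov4 by simp
  have "Z ((!) weights22) 4 = 0"
    by (rule Z_0) (simp add: rot_adj_weights22)
  then have "Z ((!) (pullback22 c p b q r)) 3 = 0"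
    using Z_step[of 3 "(!) weights22" "(!) (pullback22 c p b q r)"] push_adj_weights22[of _ c p b q r]
    by (simp add: a4)
  then have "Z ((!) (pullback22_twice c p b q r)) 2 = 0"
    using Z_step[of 2 "(!) (pullback22 c p b q r)" "(!) (pullback22_twice c p b q r)"]
      push_adj_pullback22[OF L2]
    by (simp add: a4 numeral_3_eq_3[symmetric])
  then have 5: "lyapunov5 c p b q r = 0"
    unfolding Z_2 pairing_lyapunov5 by simp
  show ?thesis
    using a4 L2 3 4 5 by blast
qed

section \<open>The Lyapunov quantities have no nontrivial real common zero\<close>

text \<open>The three Lyapunov quantities in the coordinates \<open>(h, k, s)\<close> introduced below, without their
constant factors and for \<open>c = 1\<close>; the polynomials \<open>octic\<close> and \<open>nonic\<close> come from eliminating \<open>k\<close>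
and \<open>s\<close>.\<close>

definition reduced3 :: "real \<Rightarrow> real \<Rightarrow> real \<Rightarrow> real" where
  "reduced3 h k s = (1 + k^2)*(-1*h^3 + 10*h^2 - 16*h) + (4*h^2 - 8*h) * k * s + (-6*h + 36) * s^2"

definition reduced4 :: "real \<Rightarrow> real \<Rightarrow> real \<Rightarrow> real" where
  "reduced4 h k s = (1 + k^2)*((133*h^4 - 1332*h^3 + 2184*h^2 - 320*h) * k + (769*h^3 - 9598*h^2
      + 33328*h - 34560) * s) + (-532*h^3 + 1072*h^2 - 160*h) * k^2 * s + (-2188*h^2 + 9920*h
      - 16560) * k * s^2 + (4074*h - 20988) * s^3"

definition reduced5 :: "real \<Rightarrow> real \<Rightarrow> real \<Rightarrow> real" where
  "reduced5 h k s = (1 + k^2)^2*(-39626*h^5 + 1165628*h^4 - 8225760*h^3 + 13235680*h^2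
      - 18492160*h + 30412800) + (1 + k^2)*((-54308*h^5 + 127688*h^4 + 2243904*h^3 + 3683392*h^2
      - 16007680*h) * k^2 + (-270938*h^4 + 1109048*h^3 - 1155536*h^2 - 36637440*h
      + 70502400) * k * s + (-1758977*h^3 + 26009042*h^2 - 102076880*h + 66836160) * s^2)
      + (217232*h^4 + 1227104*h^3 + 841216*h^2 - 8003840*h) * k^3 * s + (1338640*h^3 - 5482000*h^2
      - 2969792*h + 63665280) * k^2 * s^2 + (3564212*h^2 - 27423928*h + 62771040) * k * s^3
      + (-7545126*h + 36532260) * s^4"

definition octic :: "real \<Rightarrow> real" where
  "octic h = 1750*h^8 - 3575*h^7 - 219990*h^6 - 333032*h^5 + 31656928*h^4 - 241740720*h^3
      + 800044512*h^2 - 1248998400*h + 747740160"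

definition nonic :: "real \<Rightarrow> real" where
  "nonic h = -75*h^9 + 9590*h^8 - 435732*h^7 + 8030088*h^6 - 79076800*h^5 + 458126592*h^4
      - 1594122240*h^3 + 3244523520*h^2 - 3538944000*h + 1592524800"

lemma quadratic_pos:
  fixes A B C t :: real
  assumes "0 < A" "B^2 < 4*A*C"
  shows "0 < A + B*t + C*t^2"
proof -
  have "4*A*(A + B*t + C*t^2) = (2*A + B*t)^2 + (4*A*C - B^2)*t^2"
    by algebra
  moreover have "0 < \<dots>"
  proof (cases "t = 0")
    case False
    then show ?thesis using assms by (intro add_nonneg_pos mult_pos_pos) auto
  qed (use assms in simp)
  ultimately show ?thesis
    using assms(1) by (metis mult_pos_pos zero_less_mult_pos zero_less_numeral)
qed

text \<open>The sum of the negated left side and of a multiple of the octic is a positive polynomial.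
The multiplier \<open>(20 * h - 43) * (2 * h - 3)\<close> is chosen so that it is negative on one and positive
on the other of the two short intervals, near 1.9 and near 4.6, on which the left side is not
negative; there the octic has the same signs, so that the product is positive. The decomposition
into squares was obtained from the complex roots of the sum by rounding.\<close>

lemma octic_root_sign:
  fixes h :: real
  assumes r8: "octic h = 0"
  shows "(h - 2) * nonic h < 0"
proof -
  define t where "t = h - 2"
  have "100*(2 - h) * nonic h
      + (20*h - 43)*(2*h - 3) * octic h
      = (2113 + 175*t - 11636*t^2 + 1414*t^3 + 321*t^4 + 277*t^5)^2
        + (1485 - 1650*t - 64344*t^2 + 38442*t^3 - 5079*t^4)^2
        + (48470 + (- 74)*t + 155*t^2) + t^2*(31000 + 20840*t + 7000*t^2)
        + (t^2)^2*(8224 + (- 8640)*t + 6000*t^2) + (t^3)^2*(6922 + 2077*t + 1000*t^2)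
        + (t^4)^2*(662 + (- 334)*t + 771*t^2)"
    unfolding t_def octic_def nonic_def by algebra
  also have "\<dots> > 0"
    by (intro add_pos_nonneg add_nonneg_pos add_nonneg_nonneg mult_nonneg_nonneg
        zero_le_power2 quadratic_pos less_imp_le[OF quadratic_pos]) auto
  finally have "0 < 100*(2 - h) * nonic h"
    unfolding r8 by simp
  then show ?thesis
    by (auto simp: mult_less_0_iff zero_less_mult_iff)
qed

text \<open>The first equation reads \<open>K * w = s * m\<close> with \<open>w = 1 + k^2\<close> positive and \<open>m\<close> linear in \<open>k\<close>
and \<open>s\<close>. Multiplied by a power of \<open>K\<close> and reduced with it, the second equation becomes \<open>s^2 * (A *
k + B * s) = 0\<close> and the third one \<open>s^2 * G = 0\<close> with a quadratic form \<open>G\<close>. Eliminating \<open>k\<close> from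
these two leaves an octic in \<open>h\<close>. Eliminating \<open>k\<close> from the first equation instead expresses \<open>(K *
A)^2\<close> through \<open>s^2\<close> and a polynomial in \<open>h\<close>, which cannot be negative.\<close>

lemma no_real_common_zero:
  fixes h k s :: real
  assumes e3: "reduced3 h k s = 0"
    and e4: "reduced4 h k s = 0"
    and e5: "reduced5 h k s = 0"
  shows False
proof -
  define w where "w = 1 + k^2"
  define K where "K = h*(h - 2)*(h - 8)"
  define m where "m = (4*h^2 - 8*h)*k + (-6*h + 36) * s"
  have Kw: "K*w = s*m"
    using e3 unfolding reduced3_def K_def w_def m_def by algebra
  have "w > 0" unfolding w_def by (simp add: add_pos_nonneg)
  \<comment> \<open>At the zeros of \<open>K\<close> the first equation ties \<open>s\<close> to \<open>k\<close>, and the third one becomes definite.\<close>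
  have h0: "h \<noteq> 0"
  proof
    assume h: "h = 0"
    then have "s = 0" using Kw by (simp add: K_def m_def)
    then show False using e5 h \<open>w > 0\<close> by (simp add: reduced5_def w_def)
  qed
  have h2: "h \<noteq> 2"
  proof
    assume h: "h = 2"
    then have s: "s = 0" using Kw by (simp add: K_def m_def)
    have "1078272*k^4 + 3131136*k^2 + 2052864 = 0"
      using e5 h s unfolding reduced5_def by algebra
    moreover have "1078272*k^4 + 3131136*k^2 + 2052864 > 0"
      by (intro add_nonneg_pos add_nonneg_nonneg) auto
    ultimately show False by simp
  qed
  have h8: "h \<noteq> 8"
  proof
    assume h: "h = 8"
    then have "s = 0 \<or> s = 16*k" using Kw by (auto simp: K_def m_def)
    then show False
    proof
      assume s: "s = 0"
      have "6082560*w^2 = 0"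
        using e5 h s unfolding reduced5_def w_def by algebra
      then show False using \<open>w > 0\<close> by simp
    next
      assume s: "s = 16*k"
      have "1158623612928*k^4 + 9791741952*k^2 + 6082560 = 0"
        using e5 h s unfolding reduced5_def by algebra
      moreover have "1158623612928*k^4 + 9791741952*k^2 + 6082560 > 0"
        by (intro add_nonneg_pos add_nonneg_nonneg) auto
      ultimately show False by simp
    qed
  qed
  have "K \<noteq> 0" using h0 h2 h8 by (simp add: K_def)
  then have "s \<noteq> 0" using Kw \<open>w > 0\<close> by auto
  define A where "A = 5*h^5 + 2*h^4 - 96*h^3"
  define B where "B = -30*h^4 + 1308*h^3 - 15024*h^2 + 59520*h - 69120"
  have "K * reduced4 h k s
      = 18 * s^2*(A*k + B * s) + (K*w - s*m)*((133*h^4 - 1332*h^3 + 2184*h^2 - 320*h) * k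
          + (769*h^3 - 9598*h^2 + 33328*h - 34560) * s)"
    unfolding reduced4_def w_def K_def m_def A_def B_def by algebra
  then have AB: "A*k = - (B * s)"
    using e4 Kw \<open>s \<noteq> 0\<close> by simp
  define g2 where "g2 = -1480*h^9 + 10912*h^8 + 36384*h^7 - 250048*h^6 - 154496*h^5 + 890880*h^4"
  define g1 where "g1 = 1555*h^8 - 390888*h^7 + 7608420*h^6 - 52687232*h^5 + 129755520*h^4
      + 61326336*h^3 - 650219520*h^2 + 641433600*h"
  define g0 where "g0 = 43950*h^7 - 2177784*h^6 + 37049640*h^5 - 286009056*h^4 + 1035515136*h^3
      - 1491233280*h^2 + 38707200*h + 1094860800"
  define G where "G = g2*k^2 + g1*k * s + g0 * s^2"
  have "K^2 * reduced5 h k s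
      = 36 * s^2*G + (K*w - s*m)*((K*w + s*m)*(-39626*h^5 + 1165628*h^4 - 8225760*h^3
          + 13235680*h^2 - 18492160*h + 30412800) + K*((-54308*h^5 + 127688*h^4 + 2243904*h^3
          + 3683392*h^2 - 16007680*h) * k^2 + (-270938*h^4 + 1109048*h^3 - 1155536*h^2
          - 36637440*h + 70502400) * k * s + (-1758977*h^3 + 26009042*h^2 - 102076880*h
          + 66836160) * s^2))"
    unfolding reduced5_def w_def K_def m_def G_def g2_def g1_def g0_def by algebra
  then have "G = 0"
    using e5 Kw \<open>s \<noteq> 0\<close> by simp
  have "A^2*G = s^2*(h^6*(h - 8)^2*(2112 * octic h))"
  proof -
    have "A^2*G = g2*(A*k)^2 + g1*A*(A*k) * s + g0*A^2 * s^2"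
      unfolding G_def by algebra
    also have "\<dots> = s^2*(g2*B^2 - g1*A*B + g0*A^2)"
      unfolding AB by algebra
    also have "\<dots> = s^2*(h^6*(h - 8)^2*(2112 * octic h))"
      unfolding A_def B_def g2_def g1_def g0_def octic_def by algebra
    finally show ?thesis .
  qed
  then have "octic h = 0"
    using \<open>G = 0\<close> \<open>s \<noteq> 0\<close> h0 h8 by simp
  then have neg: "(h - 2) * nonic h < 0"
    by (rule octic_root_sign)
  have "(K*A)^2 = s^2*((h*(h - 8))^2*(6*((h - 2) * nonic h)))"
  proof -
    have "(K*A)^2 = K*(A^2*(K*w) - K*(A*k)^2)"
      unfolding w_def by algebra
    also have "\<dots> = K*(s*(A*((4*h^2 - 8*h)*(A*k) + A*(-6*h + 36) * s)) - K*(A*k)^2)"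
      unfolding Kw unfolding m_def by algebra
    also have "\<dots> = s^2*(K*(A*((-6*h + 36)*A - (4*h^2 - 8*h)*B) - K*B^2))"
      unfolding AB by algebra
    also have "\<dots> = s^2*((h*(h - 8))^2*(6*((h - 2) * nonic h)))"
      unfolding A_def B_def K_def nonic_def by algebra
    finally show ?thesis .
  qed
  also have "\<dots> < 0"
    using neg \<open>s \<noteq> 0\<close> h0 h8 by (simp add: mult_less_0_iff zero_less_mult_iff)
  finally show False by simp
qed

text \<open>By the second Lyapunov quantity the vectors \<open>(p - q - 7 * r, q + 4 * r)\<close> and \<open>(16 * c, b - 2
* c)\<close> are parallel, with \<open>k / 2\<close> as the factor; \<open>h\<close> is \<open>b / c + 10\<close>, and \<open>s\<close> replaces \<open>r\<close>, shifted
by a multiple of \<open>k\<close> that makes the complex solutions \<open>k^2 = -1\<close> appear at \<open>s = 0\<close>. Setting \<open>c = 4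
* d\<close> avoids fractions.\<close>

lemma lyapunov3_coordinates:
  assumes "c = 4*d" "b = 4*d*(h - 10)" "r = d*(2 * s - (h - 4)*k)"
    "q = 2*d*(h - 12)*k - 4*r" "p = 2*d*(h + 4)*k + 3*r"
  shows "lyapunov3 c p b q r = 28*(4*d)^3 * reduced3 h k s"
  unfolding lyapunov3_def reduced3_def assms(5,4) unfolding assms(1,2,3) by algebra

lemma lyapunov4_coordinates:
  assumes "c = 4*d" "b = 4*d*(h - 10)" "r = d*(2 * s - (h - 4)*k)"
    "q = 2*d*(h - 12)*k - 4*r" "p = 2*d*(h + 4)*k + 3*r"
  shows "lyapunov4 c p b q r = 56*(4*d)^4 * reduced4 h k s"
  unfolding lyapunov4_def reduced4_def assms(5,4) unfolding assms(1,2,3) by algebra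

lemma lyapunov5_coordinates:
  assumes "c = 4*d" "b = 4*d*(h - 10)" "r = d*(2 * s - (h - 4)*k)"
    "q = 2*d*(h - 12)*k - 4*r" "p = 2*d*(h + 4)*k + 3*r"
  shows "lyapunov5 c p b q r = 28*(4*d)^5 * reduced5 h k s"
  unfolding lyapunov5_def reduced5_def assms(5,4) unfolding assms(1,2,3) by algebra

text \<open>For \<open>c = 0\<close> the third quantity alone is \<open>b\<close> times a positive definite form. For \<open>c \<noteq> 0\<close> the
quantities are homogeneous, and after division by a power of \<open>c\<close> they become the three polynomials
without a common real zero.\<close>

lemma lyapunov_quantities_vanish:
  assumes L2: "b * (p - q - 7*r) = 2*c * (p + 7*q + 25*r)"
    and L3: "lyapunov3 c p b q r = 0" and L4: "lyapunov4 c p b q r = 0"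
    and L5: "lyapunov5 c p b q r = 0"
  shows "b = 0 \<and> c = 0"
proof (cases "c = 0")
  case True
  have "b = 0"
  proof (rule ccontr)
    assume "b \<noteq> 0"
    then have p: "p = q + 7*r" using L2 True by simp
    have "lyapunov3 c p b q r = - 28*b*(2*(q + 6*r)^2 + 16*r^2 + b^2)"
      unfolding lyapunov3_def True p by (simp, algebra)
    moreover have "2*(q + 6*r)^2 + 16*r^2 + b^2 > 0"
      using \<open>b \<noteq> 0\<close> by (intro add_nonneg_pos) auto
    ultimately show False using L3 \<open>b \<noteq> 0\<close> by simp
  qed
  with True show ?thesis by simp
next
  case False
  define d where "d = c/4"
  define h where "h = b/c + 10"
  define k where "k = (p - q - 7*r)/(8*c)"
  define s where "s = (r/d + (h - 4)*k)/2"
  have c: "c = 4*d" and "d \<noteq> 0" using False by (simp_all add: d_def)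
  have b: "b = 4*d*(h - 10)" using False by (simp add: h_def d_def)
  have r: "r = d*(2 * s - (h - 4)*k)" using \<open>d \<noteq> 0\<close> by (simp add: s_def field_simps)
  have k: "p = 32*d*k + q + 7*r" using False by (simp add: k_def d_def)
  have q: "q = 2*d*(h - 12)*k - 4*r"
  proof -
    have "d*q = d*(2*d*(h - 12)*k - 4*r)"
      using L2 k unfolding b c by algebra
    then show ?thesis using \<open>d \<noteq> 0\<close> by simp
  qed
  have p: "p = 2*d*(h + 4)*k + 3*r"
    using k q by (simp add: algebra_simps)
  have False
    using L3 L4 L5 \<open>d \<noteq> 0\<close> no_real_common_zero[where h = h and k = k and s = s]
    by (simp add: lyapunov3_coordinates[OF c b r q p] lyapunov4_coordinates[OF c b r q p]
        lyapunov5_coordinates[OF c b r q p])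
  then show ?thesis ..
qed

section \<open>The center problem\<close>

lemma quintic_field_eq_rotation:
  "quintic_field a05 a14 a23 a32 a41 a50 = quintic_rotation ((!) [a05, a14, a23, a32, a41, a50])"
  by (simp add: quintic_field_def atMost_5 fun_eq_iff algebra_simps)

lemma quintic_center_necessary:
  assumes "center (quintic_field a05 a14 a23 a32 a41 a50) (0, 0)"
  shows "a41 = 0 \<and> a23 = 0 \<and> a05 = 0"
proof -
  obtain H where "formal_integral ((!) [a05, a14, a23, a32, a41, a50]) H"
    using assms center_imp_formal_integral unfolding quintic_field_eq_rotation by blast
  note conditions = formal_integral_conditions[OF this]
  then have "a23 = 0 \<and> a05 = 0"
    using lyapunov_quantities_vanish by blast
  then show ?thesis using conditions by simp
qed

lemma quintic_equilibrium_on_axis: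
  "equilibrium_point (quintic_field a05 a14 a23 a32 a41 a50) (x, y) \<longleftrightarrow> y
      = 0 \<and> x * (a50 * x ^ 4 - 1) = 0"
proof -
  have "- x + a50 * x ^ 5 = x * (a50 * x ^ 4 - 1)"
    by (simp add: algebra_simps power_Suc[symmetric] del: power_Suc)
  then show ?thesis
    by (auto simp: equilibrium_point_def quintic_field_def zero_prod_def)
qed

theorem theorem2:
  fixes a05 a14 a23 a32 a41 a50 :: real
  shows "center (quintic_field a05 a14 a23 a32 a41 a50) (0, 0) \<and>
         (\<forall>p. equilibrium_point (quintic_field a05 a14 a23 a32 a41 a50) p \<longleftrightarrow> p = (0, 0))
     \<longleftrightarrow> a50 \<le> 0 \<and> a41 = 0 \<and> a23 = 0 \<and> a05 = 0"
proof
  assume *: "center (quintic_field a05 a14 a23 a32 a41 a50) (0, 0) \<and>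
         (\<forall>p. equilibrium_point (quintic_field a05 a14 a23 a32 a41 a50) p \<longleftrightarrow> p = (0, 0))"
  have "a50 \<le> 0"
  proof (rule ccontr)
    assume "\<not> a50 \<le> 0"
    then have "a50 > 0" by simp
    define x where "x = root 4 (1 / a50)"
    have "x > 0" "x ^ 4 = 1 / a50"
      using \<open>a50 > 0\<close> by (simp_all add: x_def)
    then have "equilibrium_point (quintic_field a05 a14 a23 a32 a41 a50) (x, 0)"
      using \<open>a50 > 0\<close> by (simp add: quintic_equilibrium_on_axis)
    then show False using * \<open>x > 0\<close> by auto
  qed
  then show "a50 \<le> 0 \<and> a41 = 0 \<and> a23 = 0 \<and> a05 = 0"
    using quintic_center_necessary * by blast
next
  assume *: "a50 \<le> 0 \<and> a41 = 0 \<and> a23 = 0 \<and> a05 = 0"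
  have "a50 * x ^ 4 - 1 < 0" for x
    using * by (simp add: mult_nonpos_nonneg le_less_trans[of _ 0])
  then have "equilibrium_point (quintic_field a05 a14 a23 a32 a41 a50) p \<longleftrightarrow> p = (0, 0)" for p
    by (cases p) (auto simp: quintic_equilibrium_on_axis less_le)
  then show "center (quintic_field a05 a14 a23 a32 a41 a50) (0, 0) \<and>
         (\<forall>p. equilibrium_point (quintic_field a05 a14 a23 a32 a41 a50) p \<longleftrightarrow> p = (0, 0))"
    using * quintic_center by simp
qed

end
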